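(* Let $\alpha>0$ and let $\{(X_t,t\ge 0);(\mathrm P_x)_{x\in\mathbb R^n}\}$ be a homogeneous Markov process on $\mathbb R^n$ with semigroup densities $p_t(x,y)$, positive and twice differentiable in the space and time variables. Then the Markov process $(t^\alpha X_{1/t},t>0)$ is homogeneous (under $\mathrm P_x$, for every $x$) if and only if the semigroup densities $p_t(x,y)$ are of the form $$p_t(x,y)=t^{-\frac{n\alpha}{2}}\,\Phi\Big(\frac{x}{t^{\alpha/2}},\frac{y}{t^{\alpha/2}}\Big)\,\theta\Big(\frac{y}{t^{\alpha/2}}\Big)\,\exp\Big\{\rho\Big(\frac{x}{t^{\alpha/2}}\Big)+\rho\Big(\frac{y}{t^{\alpha/2}}\Big)\Big\},\qquad(\ast)$$ or are in $h$-transform relationship with semigroup densities of this form, where the functions $\Phi,\theta,\rho$ have the following properties for all $\lambda>0$: 1. $\Phi(\lambda x,y)=\Phi(x,\lambda y)$; 2. $\rho(\lambda x)=\lambda^{2/\alpha}\rho(x)$; 3. $\theta(\lambda y)=\lambda^{\beta}\theta(y)$ for some $\beta\in\mathbb R$. Moreover, if the symmetry condition $\Phi(x,y)=\Phi(y,x)$ is satisfied, then the semigroup densities $q_t^{(x)}(a,b)$ of the time-inverted process $(t^\alpha X_{1/t},t>0)$ under $\mathrm P_x$ and the semigroup densities $p_t$ of the form $(\ast)$ are related by $$q_t^{(x)}(a,b)=\frac{\Phi(x,b)}{\Phi(x,a)}\,\exp\{t\rho(x)\}\,p_t(a,b).$$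
   Context: Semigroup densities: $P_t(x,dy)=p_t(x,y)\,dy$ with respect to Lebesgue measure on $\mathbb R^n$. Throughout, $p_t(x,y)$ is assumed to exist, to be positive over the domain, and to be at least twice differentiable in the space and time variables. Under $\mathrm P_x$, the process $(t^\alpha X_{1/t},t>0)$ is Markov, in general inhomogeneous, with transition densities, for $s<t$, $$q^{(x)}_{s,t}(a,b)=t^{-n\alpha}\,\frac{p_{1/t}\big(x,\frac{b}{t^\alpha}\big)\,p_{\frac1s-\frac1t}\big(\frac{b}{t^\alpha},\frac{a}{s^\alpha}\big)}{p_{1/s}\big(x,\frac{a}{s^\alpha}\big)}.$$ It is homogeneous if $q^{(x)}_{s,t}(a,b)$ depends on $(s,t)$ only through $t-s$; one then writes $q^{(x)}_{s,t}=q^{(x)}_{t-s}$. $h$-transform: Doob's $h$-transform is the transformation $\mathrm P_x|_{\mathcal F_t}\mapsto \frac{h(X_t)}{h(x)}e^{-\nu t}\,\mathrm P_x|_{\mathcal F_t}$ for some (positive) function $h$ and some constant $\nu\in\mathbb R$. On semigroup densities it reads $p_t(x,y)\mapsto \frac{h(y)}{h(x)}e^{-\nu t}p_t(x,y)$; two semigroup densities so related are said to be in $h$-transform relationship. *)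

theory Defs
  imports "HOL-Probability.Probability"
begin

text \<open>
  Twice Frechet differentiable. Requiring the derivative to be differentiable after evaluation at
  every fixed direction \<open>v\<close> is the same as differentiability into the dual space, because the
  domain is finite-dimensional.
\<close>
definition twice_differentiable_on ::
  "('a::euclidean_space \<Rightarrow> real) \<Rightarrow> 'a set \<Rightarrow> bool" where
  "twice_differentiable_on f U \<longleftrightarrow>
     (\<exists>f'. (\<forall>z\<in>U. (f has_derivative f' z) (at z)) \<and> (\<forall>v. (\<lambda>z. f' z v) differentiable_on U))"

text \<open>
  A Bochner integral that is not defined has the value \<open>0\<close>; since \<open>p\<close> is positive, the last two
  conditions therefore also force integrability.
\<close>
definition semigroup_densities :: "(real \<Rightarrow> real^'n \<Rightarrow> real^'n \<Rightarrow> real) \<Rightarrow> bool" where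
  "semigroup_densities p \<longleftrightarrow>
     (\<forall>t>0. \<forall>x y. p t x y > 0) \<and>
     twice_differentiable_on (\<lambda>(t, x, y). p t x y) ({0<..} \<times> UNIV \<times> UNIV) \<and>
     (\<forall>t>0. \<forall>x. (LINT y|lborel. p t x y) = 1) \<and>
     (\<forall>s>0. \<forall>t>0. \<forall>x z. p (s + t) x z = (LINT y|lborel. p s x y * p t y z))"

definition natural_filtration :: "'w measure \<Rightarrow> real set \<Rightarrow> (real \<Rightarrow> 'w \<Rightarrow> real^'n) \<Rightarrow> real \<Rightarrow> 'w measure" where
  "natural_filtration M T Y s =
     sigma (space M) (\<Union>u\<in>{u\<in>T. u \<le> s}. {Y u -` A \<inter> space M | A. A \<in> sets borel})"

text \<open>
  \<open>Y\<close>, with time set \<open>T\<close>, is under the law \<open>M\<close> a (possibly inhomogeneous) Markov process with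
  respect to its natural filtration, and \<open>q s t a\<close> is the Lebesgue density of the law of \<open>Y t\<close>
  given \<open>Y s = a\<close>.
\<close>
definition markov_with_densities ::
  "'w measure \<Rightarrow> real set \<Rightarrow> (real \<Rightarrow> 'w \<Rightarrow> real^'n) \<Rightarrow>
   (real \<Rightarrow> real \<Rightarrow> real^'n \<Rightarrow> real^'n \<Rightarrow> real) \<Rightarrow> bool" where
  "markov_with_densities M T Y q \<longleftrightarrow>
     prob_space M \<and>
     (\<forall>t\<in>T. Y t \<in> borel_measurable M) \<and>
     (\<forall>s\<in>T. \<forall>t\<in>T. s < t \<longrightarrow>
        (\<lambda>(a, b). q s t a b) \<in> borel_measurable (borel \<Otimes>\<^sub>M borel) \<and>
        (\<forall>A\<in>sets borel. AE \<omega> in M.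
           real_cond_exp M (natural_filtration M T Y s) (indicator (Y t -` A \<inter> space M)) \<omega>
             = (LINT b:A|lborel. q s t (Y s \<omega>) b)))"

definition homogeneous_markov_with_densities ::
  "'w measure \<Rightarrow> real set \<Rightarrow> (real \<Rightarrow> 'w \<Rightarrow> real^'n) \<Rightarrow>
   (real \<Rightarrow> real \<Rightarrow> real^'n \<Rightarrow> real^'n \<Rightarrow> real) \<Rightarrow> bool" where
  "homogeneous_markov_with_densities M T Y q \<longleftrightarrow>
     markov_with_densities M T Y q \<and>
     (\<exists>r. \<forall>s\<in>T. \<forall>t\<in>T. s < t \<longrightarrow> (\<forall>a b. q s t a b = r (t - s) a b))"

definition markov_family ::
  "(real^'n \<Rightarrow> 'w measure) \<Rightarrow> (real \<Rightarrow> 'w \<Rightarrow> real^'n) \<Rightarrow>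
   (real \<Rightarrow> real^'n \<Rightarrow> real^'n \<Rightarrow> real) \<Rightarrow> bool" where
  "markov_family P X p \<longleftrightarrow>
     (\<forall>x y. sets (P x) = sets (P y)) \<and>
     (\<forall>x. AE \<omega> in P x. X 0 \<omega> = x) \<and>
     (\<forall>x. markov_with_densities (P x) {0..} X (\<lambda>s t. p (t - s)))"

definition time_inversion ::
  "real \<Rightarrow> (real \<Rightarrow> 'w \<Rightarrow> real^'n) \<Rightarrow> real \<Rightarrow> 'w \<Rightarrow> real^'n" where
  "time_inversion \<alpha> X t \<omega> = (t powr \<alpha>) *\<^sub>R X (1 / t) \<omega>"

definition inversion_density ::
  "real \<Rightarrow> (real \<Rightarrow> real^'n \<Rightarrow> real^'n \<Rightarrow> real) \<Rightarrow> real^'n \<Rightarrow>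
   real \<Rightarrow> real \<Rightarrow> real^'n \<Rightarrow> real^'n \<Rightarrow> real" where
  "inversion_density \<alpha> p x s t a b =
     t powr (- (real CARD('n) * \<alpha>))
       * (p (1 / t) x (b /\<^sub>R t powr \<alpha>) * p (1 / s - 1 / t) (b /\<^sub>R t powr \<alpha>) (a /\<^sub>R s powr \<alpha>))
       / p (1 / s) x (a /\<^sub>R s powr \<alpha>)"

definition h_transform_related ::
  "(real \<Rightarrow> real^'n \<Rightarrow> real^'n \<Rightarrow> real) \<Rightarrow> (real \<Rightarrow> real^'n \<Rightarrow> real^'n \<Rightarrow> real) \<Rightarrow> bool" where
  "h_transform_related p p' \<longleftrightarrow>
     (\<exists>h \<nu>. (\<forall>x. h x > 0) \<and>
        (\<forall>t>0. \<forall>x y. p' t x y = h y / h x * exp (- \<nu> * t) * p t x y))"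

definition scaling_properties ::
  "real \<Rightarrow> (real^'n \<Rightarrow> real^'n \<Rightarrow> real) \<Rightarrow> (real^'n \<Rightarrow> real) \<Rightarrow> (real^'n \<Rightarrow> real) \<Rightarrow> bool" where
  "scaling_properties \<alpha> \<Phi> \<theta> \<rho> \<longleftrightarrow>
     (\<forall>c>0. \<forall>x y. \<Phi> (c *\<^sub>R x) y = \<Phi> x (c *\<^sub>R y)) \<and>
     (\<forall>c>0. \<forall>x. \<rho> (c *\<^sub>R x) = c powr (2 / \<alpha>) * \<rho> x) \<and>
     (\<exists>\<beta>. \<forall>c>0. \<forall>y. \<theta> (c *\<^sub>R y) = c powr \<beta> * \<theta> y)"

definition has_inversion_form ::
  "real \<Rightarrow> (real^'n \<Rightarrow> real^'n \<Rightarrow> real) \<Rightarrow> (real^'n \<Rightarrow> real) \<Rightarrow> (real^'n \<Rightarrow> real) \<Rightarrow>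
   (real \<Rightarrow> real^'n \<Rightarrow> real^'n \<Rightarrow> real) \<Rightarrow> bool" where
  "has_inversion_form \<alpha> \<Phi> \<theta> \<rho> p \<longleftrightarrow>
     scaling_properties \<alpha> \<Phi> \<theta> \<rho> \<and>
     (\<forall>t>0. \<forall>x y. p t x y =
        t powr (- (real CARD('n) * \<alpha> / 2))
          * \<Phi> (x /\<^sub>R t powr (\<alpha> / 2)) (y /\<^sub>R t powr (\<alpha> / 2))
          * \<theta> (y /\<^sub>R t powr (\<alpha> / 2))
          * exp (\<rho> (x /\<^sub>R t powr (\<alpha> / 2)) + \<rho> (y /\<^sub>R t powr (\<alpha> / 2))))"

end

theory Submission
  imports Defs "HOL-Real_Asymp.Real_Asymp"
begin

text \<open>
  Reversing the time of a Markov process gives a Markov process again, whose transition densities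
  are given by Bayes' rule. With the start at \<open>x\<close> and the rescaling of space these are the densities
  \<^const>\<open>inversion_density\<close> (\<open>markov_backward_transition\<close>, \<open>markov_time_inversion\<close>). So the inverted process is always
  Markov with these densities, and its homogeneity is a property of \<open>p\<close> alone.

  If \<open>p\<close> has the form of the theorem, then inserting it shows that all powers of the times and all
  exponents combine into functions of \<open>t - s\<close> (\<open>inversion_density_of_form\<close>); for symmetric \<open>\<Phi>\<close> the result is the
  formula of the second claim. An \<open>h\<close>-transform does not change the inverted density
  (\<open>inversion_density_h_transform\<close>).

  Conversely, homogeneity is a functional equation for
  \<open>E x t b = ln (p (1 / t) x (b /\<^sub>R t powr \<alpha>))\<close>. Its dependence on \<open>x\<close> forces
  \<open>E x t b = E 0 t b + c x * t + G x b\<close>; the special case \<open>a = 0\<close> forces \<open>c\<close> to be homogeneous of degree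
  \<open>2 / \<alpha>\<close> and determines \<open>E 0 t b\<close> up to \<open>E 0 t 0\<close>; the case \<open>a = b = 0\<close> is a Cauchy equation that
  determines \<open>E 0 t 0\<close>; and what is left says that the remaining term is a function \<open>\<psi>\<close> with
  \<open>\<psi> (r *\<^sub>R x) y = \<psi> x (r *\<^sub>R y)\<close> (\<open>log_density_decomposition\<close>). Thus \<open>p\<close> is the product of a kernel \<open>p'\<close> of the required
  form and of factors \<open>exp (\<nu> * t)\<close> and \<open>exp (g x) / exp (g y)\<close>, which is an \<open>h\<close>-transform.

  It remains to see that \<open>p'\<close> consists of semigroup densities. The difficulty is its total mass,
  since removing an \<open>h\<close>-transform need not preserve the mass of a kernel. Here it does:
  \<open>p' t x 0 = C * t powr (- \<kappa>) * exp (c x / t)\<close>, and letting \<open>s \<rightarrow> \<infinity>\<close> in the Chapman-Kolmogorov equation with times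
  \<open>t\<close> and \<open>s\<close> and endpoint \<open>0\<close> yields the mass one (\<open>Chapman_Kolmogorov_total_mass_one\<close>).
\<close>

section \<open>Inverted densities of the scaling form\<close>

lemma scaling_property_divideR:
  fixes \<Phi> :: "'a::real_vector \<Rightarrow> 'a \<Rightarrow> real"
  assumes "\<forall>c>0. \<forall>x y. \<Phi> (c *\<^sub>R x) y = \<Phi> x (c *\<^sub>R y)" "c > 0" "d > 0"
  shows "\<Phi> (x /\<^sub>R c) (y /\<^sub>R d) = \<Phi> x (y /\<^sub>R (c * d))"
  using assms(1)[rule_format, of "inverse c" x "y /\<^sub>R d"] assms(2,3)
  by simp

lemma homogeneous_divideR_powr:
  fixes \<rho> :: "'a::real_vector \<Rightarrow> real"
  assumes "\<alpha> > 0" and \<rho>: "\<And>c x. c > 0 \<Longrightarrow> \<rho> (c *\<^sub>R x) = c powr (2 / \<alpha>) * \<rho> x"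
    and "r > 0"
  shows "\<rho> (x /\<^sub>R r powr \<alpha>) = \<rho> x / r\<^sup>2"
proof -
  have "inverse (r powr \<alpha>) powr (2 / \<alpha>) = r powr (- \<alpha> * (2 / \<alpha>))"
    by (simp only: powr_minus[symmetric] powr_powr)
  also have "- \<alpha> * (2 / \<alpha>) = - 2" using assms by simp
  also have "r powr - 2 = 1 / r\<^sup>2"
    using assms by (simp add: powr_minus powr_numeral divide_inverse)
  finally show ?thesis using \<rho>[of "inverse (r powr \<alpha>)" x] \<open>r > 0\<close> by simp
qed

lemma homogeneous_divideR_powr_half:
  fixes \<rho> :: "'a::real_vector \<Rightarrow> real"
  assumes "\<alpha> > 0" and "\<And>c x. c > 0 \<Longrightarrow> \<rho> (c *\<^sub>R x) = c powr (2 / \<alpha>) * \<rho> x"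
    and "t > 0"
  shows "\<rho> (x /\<^sub>R t powr (\<alpha> / 2)) = \<rho> x / t"
proof -
  have "t powr (\<alpha> / 2) = sqrt t powr \<alpha>"
    using \<open>t > 0\<close> by (simp add: powr_half_sqrt[symmetric] powr_powr)
  thus ?thesis
    using homogeneous_divideR_powr[OF assms(1,2), of "sqrt t" x] \<open>t > 0\<close> by simp
qed

text \<open>
  The scaling properties move all factors \<open>t powr (\<alpha> / 2)\<close> out of the first argument of \<open>\<Phi>\<close>, out of
  \<open>\<theta>\<close> and out of \<open>\<rho>\<close>. In this shape the powers of the three times that occur in
  \<^const>\<open>inversion_density\<close> can be collected.
\<close>

lemma inversion_form_unscaled:
  fixes p :: "real \<Rightarrow> real^'n \<Rightarrow> real^'n \<Rightarrow> real"
  assumes "\<alpha> > 0" and form: "has_inversion_form \<alpha> \<Phi> \<theta> \<rho> p"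
  obtains \<beta> where
    "\<And>c y. c > 0 \<Longrightarrow> \<theta> (y /\<^sub>R c) = c powr (- \<beta>) * \<theta> y"
    "\<And>t x y. t > 0 \<Longrightarrow> p t x y =
       t powr (- (real CARD('n) * \<alpha> / 2)) * \<Phi> x (y /\<^sub>R t powr \<alpha>)
         * (t powr (- (\<alpha> * \<beta> / 2)) * \<theta> y) * exp ((\<rho> x + \<rho> y) / t)"
proof -
  from form obtain \<beta> where \<Phi>: "\<forall>c>0. \<forall>x y. \<Phi> (c *\<^sub>R x) y = \<Phi> x (c *\<^sub>R y)"
    and \<rho>: "\<And>c x. c > 0 \<Longrightarrow> \<rho> (c *\<^sub>R x) = c powr (2 / \<alpha>) * \<rho> x"
    and \<theta>: "\<And>c y. c > 0 \<Longrightarrow> \<theta> (c *\<^sub>R y) = c powr \<beta> * \<theta> y"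
    and p: "\<And>t x y. t > 0 \<Longrightarrow> p t x y = t powr (- (real CARD('n) * \<alpha> / 2))
          * \<Phi> (x /\<^sub>R t powr (\<alpha> / 2)) (y /\<^sub>R t powr (\<alpha> / 2))
          * \<theta> (y /\<^sub>R t powr (\<alpha> / 2))
          * exp (\<rho> (x /\<^sub>R t powr (\<alpha> / 2)) + \<rho> (y /\<^sub>R t powr (\<alpha> / 2)))"
    unfolding has_inversion_form_def scaling_properties_def by metis
  have \<theta>': "\<theta> (y /\<^sub>R c) = c powr (- \<beta>) * \<theta> y" if "c > 0" for c y
    using \<theta>[of "inverse c" y] that by (simp add: powr_minus inverse_powr)
  show ?thesis
  proof (rule that[OF \<theta>'])
    fix t :: real and x y assume t: "t > 0"
    have "\<rho> (z /\<^sub>R t powr (\<alpha> / 2)) = \<rho> z / t" for z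
      by (rule homogeneous_divideR_powr_half[OF \<open>\<alpha> > 0\<close> \<rho> t])
    moreover have "\<Phi> (x /\<^sub>R t powr (\<alpha> / 2)) (y /\<^sub>R t powr (\<alpha> / 2)) = \<Phi> x (y /\<^sub>R t powr \<alpha>)"
      using scaling_property_divideR[OF \<Phi>, of "t powr (\<alpha> / 2)" "t powr (\<alpha> / 2)" x y] t
      by (simp add: powr_add[symmetric])
    moreover have "\<theta> (y /\<^sub>R t powr (\<alpha> / 2)) = t powr (- (\<alpha> * \<beta> / 2)) * \<theta> y"
      using \<theta>'[of "t powr (\<alpha> / 2)" y] t by (simp add: powr_powr)
    ultimately show "p t x y = t powr (- (real CARD('n) * \<alpha> / 2)) * \<Phi> x (y /\<^sub>R t powr \<alpha>)
         * (t powr (- (\<alpha> * \<beta> / 2)) * \<theta> y) * exp ((\<rho> x + \<rho> y) / t)"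
      by (simp add: p[OF t] add_divide_distrib)
  qed simp
qed

text \<open>
  Write \<open>u = t - s\<close> and \<open>\<tau> = 1 / s - 1 / t = u / (s * t)\<close>. Every power of \<open>t\<close>, \<open>\<tau>\<close> and \<open>s\<close> in the
  inverted density combines into a power of \<open>t * \<tau> * s = u\<close>, and the exponents simplify by
  \<open>1 / t + s / (t * u) = 1 / u\<close> and \<open>t / (s * u) - 1 / s = 1 / u\<close>. What remains differs from
  \<open>p u a b\<close> in the order of the arguments of \<open>\<Phi>\<close> and in the factor that depends on \<open>x\<close>; the
  auxiliary \<open>k\<close> is the part that the two densities share.
\<close>

lemma inversion_density_of_form:
  fixes p :: "real \<Rightarrow> real^'n \<Rightarrow> real^'n \<Rightarrow> real"
  assumes "\<alpha> > 0" and form: "has_inversion_form \<alpha> \<Phi> \<theta> \<rho> p"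
    and pos: "\<And>t x y. t > 0 \<Longrightarrow> p t x y > 0"
  obtains k where
    "\<And>u a b. u > 0 \<Longrightarrow> p u a b = \<Phi> a (b /\<^sub>R u powr \<alpha>) * k u a b"
    "\<And>x s t a b. 0 < s \<Longrightarrow> s < t \<Longrightarrow> inversion_density \<alpha> p x s t a b =
       \<Phi> x b / \<Phi> x a * exp ((t - s) * \<rho> x) * (\<Phi> b (a /\<^sub>R (t - s) powr \<alpha>) * k (t - s) a b)"
proof -
  define \<kappa> where "\<kappa> = real CARD('n) * \<alpha> / 2"
  from form have \<Phi>: "\<forall>c>0. \<forall>x y. \<Phi> (c *\<^sub>R x) y = \<Phi> x (c *\<^sub>R y)"
    and \<rho>0: "\<And>c x. c > 0 \<Longrightarrow> \<rho> (c *\<^sub>R x) = c powr (2 / \<alpha>) * \<rho> x"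
    unfolding has_inversion_form_def scaling_properties_def by auto
  obtain \<beta> where
    \<theta>: "\<And>c y. c > 0 \<Longrightarrow> \<theta> (y /\<^sub>R c) = c powr (- \<beta>) * \<theta> y" and
    p: "\<And>t x y. t > 0 \<Longrightarrow> p t x y =
       t powr (- \<kappa>) * \<Phi> x (y /\<^sub>R t powr \<alpha>)
         * (t powr (- (\<alpha> * \<beta> / 2)) * \<theta> y) * exp ((\<rho> x + \<rho> y) / t)"
    unfolding \<kappa>_def by (rule inversion_form_unscaled[OF assms(1,2)]) blast
  have \<rho>: "\<rho> (z /\<^sub>R r powr \<alpha>) = \<rho> z / r\<^sup>2" if "r > 0" for z r
    by (rule homogeneous_divideR_powr[OF \<open>\<alpha> > 0\<close> \<rho>0 that])
  have \<theta>a: "\<theta> (z /\<^sub>R r powr \<alpha>) = r powr (- (\<alpha> * \<beta>)) * \<theta> z" if "r > 0" for z r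
    using \<theta>[of "r powr \<alpha>" z] that by (simp add: powr_powr)
  have nz: "\<Phi> x y \<noteq> 0" "\<theta> y \<noteq> 0" for x y
    using pos[of 1 x y] p[of 1 x y] by auto
  define k where "k u a b = u powr (- \<kappa>) * (u powr (- (\<alpha> * \<beta> / 2)) * \<theta> b) * exp ((\<rho> a + \<rho> b) / u)"
    for u a b
  show ?thesis
  proof (rule that[of k])
    show "p u a b = \<Phi> a (b /\<^sub>R u powr \<alpha>) * k u a b" if "u > 0" for u a b
      using that by (simp add: p k_def mult_ac)
  next
    fix x a b :: "real^'n" and s t :: real assume st: "0 < s" "s < t"
    define u where "u = t - s"
    define \<tau> where "\<tau> = 1 / s - 1 / t"
    have pos': "t > 0" "u > 0" "\<tau> > 0" using st by (auto simp: u_def \<tau>_def frac_less2)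
    have \<tau>u: "\<tau> = u / (s * t)" using st by (simp add: \<tau>_def u_def field_simps)
    have e1: "p (1 / r) x (z /\<^sub>R r powr \<alpha>) = r powr \<kappa> * \<Phi> x z *
        (r powr (- (\<alpha> * \<beta> / 2)) * \<theta> z) * exp (r * \<rho> x + \<rho> z / r)" if "r > 0" for r z
    proof -
      have "(1 / r) powr \<alpha> * r powr \<alpha> = 1" using that by (simp add: powr_mult[symmetric])
      hence "z /\<^sub>R r powr \<alpha> /\<^sub>R (1 / r) powr \<alpha> = z"
        by (metis divide_inverse_commute inverse_1 inverse_mult_distrib
              mult.commute mult_1 scaleR_one scaleR_scaleR)
      moreover have "(1 / r) powr (- \<kappa>) = r powr \<kappa>"
        using that by (simp add: powr_divide powr_minus)
      moreover have "(1 / r) powr (- (\<alpha> * \<beta> / 2)) * (r powr (- (\<alpha> * \<beta>)) * \<theta> z) =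
          r powr (- (\<alpha> * \<beta> / 2)) * \<theta> z"
      proof -
        have "(1 / r) powr (- (\<alpha> * \<beta> / 2)) = r powr (\<alpha> * \<beta> / 2)"
          using that by (simp add: powr_divide powr_minus)
        moreover have "r powr (\<alpha> * \<beta> / 2) * r powr (- (\<alpha> * \<beta>)) = r powr (- (\<alpha> * \<beta> / 2))"
          by (simp add: powr_add[symmetric])
        ultimately show ?thesis by (metis mult.assoc)
      qed
      moreover have "(\<rho> x + \<rho> z / r\<^sup>2) / (1 / r) = r * \<rho> x + \<rho> z / r"
        using that by (simp add: field_simps power2_eq_square)
      ultimately show ?thesis
        using that by (simp add: p \<rho> \<theta>a)
    qed
    have e2: "p \<tau> (b /\<^sub>R t powr \<alpha>) (a /\<^sub>R s powr \<alpha>) =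
        \<tau> powr (- \<kappa>) * \<Phi> b (a /\<^sub>R u powr \<alpha>) *
        (\<tau> powr (- (\<alpha> * \<beta> / 2)) * (s powr (- (\<alpha> * \<beta>)) * \<theta> a)) *
        exp ((\<rho> b / t\<^sup>2 + \<rho> a / s\<^sup>2) / \<tau>)"
    proof -
      have "t powr \<alpha> * (\<tau> powr \<alpha> * s powr \<alpha>) = u powr \<alpha>"
        using st pos' by (simp add: powr_mult[symmetric] \<tau>u)
      moreover have "\<Phi> (b /\<^sub>R t powr \<alpha>) (a /\<^sub>R s powr \<alpha> /\<^sub>R \<tau> powr \<alpha>) =
          \<Phi> (b /\<^sub>R t powr \<alpha>) (a /\<^sub>R (\<tau> powr \<alpha> * s powr \<alpha>))"
        by (simp add: mult.commute)
      ultimately show ?thesis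
        using st pos' scaling_property_divideR[OF \<Phi>, of "t powr \<alpha>" "\<tau> powr \<alpha> * s powr \<alpha>" b a]
        by (simp add: p \<rho> \<theta>a)
    qed
    have expo: "(t * \<rho> x + \<rho> b / t) + (\<rho> b / t\<^sup>2 + \<rho> a / s\<^sup>2) / \<tau> - (s * \<rho> x + \<rho> a / s) =
        u * \<rho> x + (\<rho> a + \<rho> b) / u"
    proof -
      have "(\<rho> b / t\<^sup>2 + \<rho> a / s\<^sup>2) / \<tau> = \<rho> b * (s / (t * u)) + \<rho> a * (t / (s * u))"
        unfolding \<tau>u using st pos' by (simp add: field_simps power2_eq_square)
      moreover have "\<rho> b / t = \<rho> b * (1 / u) - \<rho> b * (s / (t * u))"
        "\<rho> a / s = \<rho> a * (t / (s * u)) - \<rho> a * (1 / u)"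
      proof -
        have "1 / u - s / (t * u) = 1 / t" "t / (s * u) - 1 / u = 1 / s"
          using st pos' by (simp_all add: divide_simps) (simp_all add: u_def algebra_simps)
        thus "\<rho> b / t = \<rho> b * (1 / u) - \<rho> b * (s / (t * u))"
          "\<rho> a / s = \<rho> a * (t / (s * u)) - \<rho> a * (1 / u)"
          by (simp_all only: right_diff_distrib[symmetric]) simp_all
      qed
      moreover have "u * \<rho> x = t * \<rho> x - s * \<rho> x" by (simp add: u_def algebra_simps)
      ultimately show ?thesis by (simp add: add_divide_distrib)
    qed
    have pk: "t powr (- (2 * \<kappa>)) * t powr \<kappa> * \<tau> powr (- \<kappa>) = u powr (- \<kappa>) * s powr \<kappa>"
    proof -
      have "t powr (- (2 * \<kappa>)) * t powr \<kappa> * \<tau> powr (- \<kappa>) = t powr (- \<kappa>) * \<tau> powr (- \<kappa>)"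
        by (simp add: powr_add[symmetric])
      also have "\<dots> = (u / s) powr (- \<kappa>)" using st pos' by (simp add: powr_mult[symmetric] \<tau>u)
      also have "\<dots> = u powr (- \<kappa>) * s powr \<kappa>"
        using st pos' by (simp add: powr_divide) (simp add: powr_minus divide_inverse)
      finally show ?thesis .
    qed
    have pb: "t powr (- (\<alpha> * \<beta> / 2)) * (\<tau> powr (- (\<alpha> * \<beta> / 2)) * s powr (- (\<alpha> * \<beta>))) =
        u powr (- (\<alpha> * \<beta> / 2)) * s powr (- (\<alpha> * \<beta> / 2))"
    proof -
      have "s powr (- (\<alpha> * \<beta>)) = s powr (- (\<alpha> * \<beta> / 2)) * s powr (- (\<alpha> * \<beta> / 2))"
        by (simp add: powr_add[symmetric])
      moreover have "t powr (- (\<alpha> * \<beta> / 2)) * (\<tau> powr (- (\<alpha> * \<beta> / 2)) * s powr (- (\<alpha> * \<beta> / 2)))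
           = u powr (- (\<alpha> * \<beta> / 2))"
        using st pos' by (simp add: powr_mult[symmetric] \<tau>u)
      ultimately show ?thesis by (metis mult.assoc)
    qed
    have q: "inversion_density \<alpha> p x s t a b =
      t powr (- (2 * \<kappa>)) *
       ((t powr \<kappa> * \<Phi> x b * (t powr (- (\<alpha> * \<beta> / 2)) * \<theta> b) * exp (t * \<rho> x + \<rho> b / t)) *
        (\<tau> powr (- \<kappa>) * \<Phi> b (a /\<^sub>R u powr \<alpha>) *
        (\<tau> powr (- (\<alpha> * \<beta> / 2)) * (s powr (- (\<alpha> * \<beta>)) * \<theta> a)) *
        exp ((\<rho> b / t\<^sup>2 + \<rho> a / s\<^sup>2) / \<tau>))) /
       (s powr \<kappa> * \<Phi> x a * (s powr (- (\<alpha> * \<beta> / 2)) * \<theta> a) * exp (s * \<rho> x + \<rho> a / s))"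
      unfolding inversion_density_def e1[OF st(1)] e1[OF pos'(1)]
      using e2 by (simp add: \<tau>_def \<kappa>_def)
    have "\<dots> = (t powr (- (2 * \<kappa>)) * t powr \<kappa> * \<tau> powr (- \<kappa>)) *
        (t powr (- (\<alpha> * \<beta> / 2)) * (\<tau> powr (- (\<alpha> * \<beta> / 2)) * s powr (- (\<alpha> * \<beta>)))) *
        (\<Phi> x b * \<Phi> b (a /\<^sub>R u powr \<alpha>) * \<theta> b * \<theta> a) *
        (exp (t * \<rho> x + \<rho> b / t) * exp ((\<rho> b / t\<^sup>2 + \<rho> a / s\<^sup>2) / \<tau>) / exp (s * \<rho> x + \<rho> a / s)) /
        (s powr \<kappa> * \<Phi> x a * (s powr (- (\<alpha> * \<beta> / 2)) * \<theta> a))"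
      by (simp add: mult_ac)
    also have "exp (t * \<rho> x + \<rho> b / t) * exp ((\<rho> b / t\<^sup>2 + \<rho> a / s\<^sup>2) / \<tau>) / exp (s * \<rho> x + \<rho> a / s) =
        exp (u * \<rho> x) * exp ((\<rho> a + \<rho> b) / u)"
      by (simp only: exp_add[symmetric] exp_diff[symmetric] expo)
    also note pk
    also note pb
    finally show "inversion_density \<alpha> p x s t a b =
       \<Phi> x b / \<Phi> x a * exp ((t - s) * \<rho> x) * (\<Phi> b (a /\<^sub>R (t - s) powr \<alpha>) * k (t - s) a b)"
      unfolding q using st pos' nz(1)[of x a] nz(2)[of a] by (simp add: u_def[symmetric] k_def)
  qed
qed

text \<open>
  Along the cycle formed by the three densities the quotients of \<open>h\<close> telescope, and the exponential
  factors cancel because \<open>1 / t + (1 / s - 1 / t) = 1 / s\<close>.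
\<close>

lemma inversion_density_h_transform:
  assumes "h_transform_related p' p" "0 < s" "s < t"
  shows "inversion_density \<alpha> p x s t a b = inversion_density \<alpha> p' x s t a b"
proof -
  from assms obtain h \<nu> where h: "\<And>x. h x > 0"
    and p: "\<And>t x y. t > 0 \<Longrightarrow> p t x y = h y / h x * exp (- \<nu> * t) * p' t x y"
    unfolding h_transform_related_def by blast
  have nz: "h x \<noteq> 0" for x using h[of x] by simp
  have \<tau>: "1 / s - 1 / t > 0" using assms by (auto simp: frac_less2)
  have "exp (- \<nu> * (1 / t)) * exp (- \<nu> * (1 / s - 1 / t)) = exp (- \<nu> * (1 / s))"
    unfolding exp_add[symmetric] by (simp add: algebra_simps)
  thus ?thesis
    using assms \<tau> nz unfolding inversion_density_def p[OF \<tau>] by (simp add: p divide_simps)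
qed

section \<open>The functional equation of homogeneity\<close>

text \<open>
  The derivative of \<open>f\<close> is invariant under translations, because \<open>f (t + u) - f t\<close> is constant in \<open>t\<close>.
\<close>

lemma affine_if_increments_translation_invariant:
  fixes f k :: "real \<Rightarrow> real"
  assumes diff: "\<And>t. t > 0 \<Longrightarrow> f differentiable (at t)"
    and incr: "\<And>s u. s > 0 \<Longrightarrow> u > 0 \<Longrightarrow> f (s + u) - f s = k u"
  obtains c d where "\<And>t. t > 0 \<Longrightarrow> f t = c * t + d"
proof -
  define f' where "f' t = deriv f t" for t
  have f': "(f has_real_derivative f' t) (at t)" if "t > 0" for t
    using diff[OF that] unfolding f'_def
    by (metis DERIV_deriv_iff_real_differentiable)
  have shift: "f' (t + u) = f' t" if "t > 0" "u > 0" for t u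
  proof -
    have "((\<lambda>r. f (r + u)) has_real_derivative f' (t + u)) (at t)"
      using f'[of "t + u"] that by (simp add: DERIV_shift)
    hence "((\<lambda>r. f (r + u) - f r) has_real_derivative f' (t + u) - f' t) (at t)"
      using f'[OF that(1)] by (rule DERIV_diff)
    moreover have "((\<lambda>r. f (r + u) - f r) has_real_derivative 0) (at t)"
    proof (rule DERIV_cong_ev[THEN iffD2, OF refl _ refl DERIV_const[of "k u"]])
      show "\<forall>\<^sub>F r in nhds t. f (r + u) - f r = k u"
        using eventually_nhds_in_open[of "{0<..}" t] that incr
        by (auto elim!: eventually_mono)
    qed
    ultimately show ?thesis using DERIV_unique by fastforce
  qed
  have const: "f' t = f' 1" if "t > 0" for t
    using shift[of 1 "t - 1"] shift[of t "1 - t"] that by (cases t "1::real" rule: linorder_cases) auto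
  have "\<exists>d. \<forall>t\<in>{0<..}. f t - f' 1 * t = d"
  proof (rule has_field_derivative_zero_constant)
    fix t :: real assume "t \<in> {0<..}"
    hence t: "t > 0" by simp
    have "((\<lambda>t. f t - f' 1 * t) has_real_derivative f' t - f' 1) (at t)"
      by (auto intro!: derivative_eq_intros f' t)
    thus "((\<lambda>t. f t - f' 1 * t) has_real_derivative 0) (at t within {0<..})"
      using const[OF t] by (simp add: has_field_derivative_at_within)
  qed simp
  then obtain d where "\<And>t. t > 0 \<Longrightarrow> f t - f' 1 * t = d" by auto
  hence "f t = f' 1 * t + d" if "t > 0" for t using that by fastforce
  thus ?thesis using that by blast
qed

text \<open>
  The intended instance is \<open>E x t b = ln (p (1 / t) x (b /\<^sub>R t powr \<alpha>))\<close> and \<open>N = n * \<alpha>\<close>. In terms of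
  this \<open>E\<close> the logarithm of \<open>inversion_density \<alpha> p x s t a b\<close> is the left-hand side of \<open>hom\<close>: the
  middle density, which runs from \<open>b /\<^sub>R t powr \<alpha>\<close> for the time \<open>1 / s - 1 / t\<close>, is again a value of \<open>E\<close>,
  at the inverse time \<open>s * t / (t - s)\<close>. Homogeneity says that the result is a function of \<open>t - s\<close>.
\<close>

locale homogeneous_log_density =
  fixes \<alpha> N :: real and E :: "'a::real_vector \<Rightarrow> real \<Rightarrow> 'a \<Rightarrow> real"
    and R :: "'a \<Rightarrow> real \<Rightarrow> 'a \<Rightarrow> 'a \<Rightarrow> real"
  assumes \<alpha>: "\<alpha> > 0"
    and diff: "t > 0 \<Longrightarrow> (\<lambda>t. E x t b) differentiable (at t)"
    and hom: "0 < s \<Longrightarrow> s < t \<Longrightarrow>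
      - N * ln t + E x t b - E x s a
        + E (b /\<^sub>R t powr \<alpha>) (s * t / (t - s)) (t powr \<alpha> *\<^sub>R a /\<^sub>R (t - s) powr \<alpha>) = R x (t - s) a b"
begin

text \<open>
  Subtracting the equation for the starting point \<open>0\<close> from the one for \<open>x\<close> removes the middle density.
  The increments of \<open>t \<mapsto> E x t b - E 0 t b\<close> then depend on the increment of \<open>t\<close> alone, which makes
  this function affine; taking increments between different \<open>a\<close> and \<open>b\<close> shows that the slope is the
  same for all \<open>b\<close>.
\<close>

lemma starting_point_dependence:
  obtains c G where "\<And>x t b. t > 0 \<Longrightarrow> E x t b = E 0 t b + c x * t + G x b"
    "c 0 = 0" "\<And>b. G 0 b = 0"
proof -
  have "\<exists>c d. \<forall>t>0. \<forall>b. E x t b - E 0 t b = c * t + d b" for x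
  proof -
    define D where "D t b = E x t b - E 0 t b" for t b
    have D: "D t b - D s a = R x (t - s) a b - R 0 (t - s) a b" if "0 < s" "s < t" for s t a b
      using hom[OF that, of x b a] hom[OF that, of 0 b a] by (simp add: D_def)
    have "\<exists>c d. \<forall>t>0. D t b = c * t + d" for b
    proof -
      have 1: "(\<lambda>t. D t b) differentiable (at t)" if "t > 0" for t
        unfolding D_def by (intro differentiable_diff diff that)
      have 2: "D (s + u) b - D s b = R x u b b - R 0 u b b" if "s > 0" "u > 0" for s u
        using D[of s "s + u" b b] that by simp
      show ?thesis by (rule affine_if_increments_translation_invariant[OF 1 2]) blast+
    qed
    then obtain c d where cd: "\<And>t b. t > 0 \<Longrightarrow> D t b = c b * t + d b" by metis
    have "c b = c 0" for b
      using D[of 1 2 b 0] D[of 2 3 b 0] by (simp add: cd)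
    hence "\<forall>t>0. \<forall>b. E x t b - E 0 t b = c 0 * t + d b"
      using cd unfolding D_def by simp
    thus ?thesis by blast
  qed
  then obtain c d where cd: "\<And>x t b. t > 0 \<Longrightarrow> E x t b - E 0 t b = c x * t + d x b" by metis
  have eqs: "c 0 * 1 + d 0 b = 0" "c 0 * 2 + d 0 b = 0" for b
    using cd[of 1 0 b] cd[of 2 0 b] by auto
  have "c 0 = 0" using eqs[of 0] by linarith
  moreover have "d 0 b = 0" for b using eqs[of b] by linarith
  moreover have "E x t b = E 0 t b + c x * t + d x b" if "t > 0" for x t b
    using cd[OF that, of x b] by simp
  ultimately show ?thesis using that by blast
qed

text \<open>
  For \<open>x = a = b = 0\<close> put \<open>m \<tau> = E 0 (1 / \<tau>) 0 + N / 2 * ln \<tau>\<close>. The logarithmic term is chosen such that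
  \<open>m y + m z - m (y + z)\<close> is a function \<open>K\<close> of \<open>z / (y * (y + z))\<close> alone. As the sum is symmetric in \<open>y\<close> and \<open>z\<close>,
  \<open>K\<close> takes the same value at \<open>z / (y * (y + z))\<close> and \<open>y / (z * (y + z))\<close>. Any two positive reals are such
  a pair, so \<open>K\<close> is constant and \<open>m\<close> solves Cauchy's equation up to a constant.
\<close>

lemma diagonal_value:
  obtains \<nu> C where "\<And>t. t > 0 \<Longrightarrow> E 0 (1 / t) 0 = \<nu> * t + C - N / 2 * ln t"
proof -
  define m where "m \<tau> = E 0 (1 / \<tau>) 0 + N / 2 * ln \<tau>" for \<tau>
  define K where "K u = R 0 u 0 0 + N / 2 * ln u" for u
  have mK: "m y - m (y + z) + m z = K (z / (y * (y + z)))" if yz: "y > 0" "z > 0" for y z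
  proof -
    have u: "1 / y - 1 / (y + z) = z / (y * (y + z))" using yz by (simp add: field_simps)
    have q: "(1 / (y + z)) * (1 / y) / (z / (y * (y + z))) = 1 / z" using yz by simp
    have "0 < 1 / (y + z)" "1 / (y + z) < 1 / y" using yz by (auto simp: frac_less2)
    from hom[OF this, of 0 0 0]
    have "- N * ln (1 / y) + E 0 (1 / y) 0 - E 0 (1 / (y + z)) 0 + E 0 (1 / z) 0 = R 0 (z / (y * (y + z))) 0 0"
      unfolding u q by simp
    moreover have "ln (1 / y) = - ln y" "ln (z / (y * (y + z))) = ln z - ln y - ln (y + z)"
      using yz by (simp_all add: ln_div ln_mult)
    ultimately show ?thesis unfolding m_def K_def by (simp only:) argo
  qed
  have K: "K A = K B" if "A > 0" "B > 0" for A B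
  proof -
    define a b where "a = sqrt A" and "b = sqrt B"
    have ab: "a > 0" "b > 0" "A = a\<^sup>2" "B = b\<^sup>2" using that by (auto simp: a_def b_def)
    \<comment> \<open>\<open>y\<close> and \<open>z\<close> solve \<open>z / y = a / b\<close> and \<open>y + z = 1 / (a * b)\<close>, which is what the two required
      identities amount to.\<close>
    define q where "q = a + b"
    have q: "q > 0" using ab by (simp add: q_def)
    define y z where "y = 1 / (a * q)" and "z = 1 / (b * q)"
    have yz: "y > 0" "z > 0" using ab q by (auto simp: y_def z_def)
    have "y + z = (a + b) / (a * b * q)"
      using ab q unfolding y_def z_def by (simp add: divide_simps)
    hence s: "y + z = 1 / (a * b)" using q by (simp add: q_def[symmetric])
    have "z / (y * (y + z)) = A" "y / (z * (y + z)) = B"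
      unfolding s unfolding y_def z_def using ab q by (simp_all add: power2_eq_square)
    thus ?thesis using mK[of y z] mK[of z y] yz by (simp add: add.commute)
  qed
  have dm: "m differentiable (at \<tau>)" if "\<tau> > 0" for \<tau>
  proof -
    have "(\<lambda>t. E 0 t 0) differentiable (at (1 / \<tau>))" using diff that by simp
    moreover have "(\<lambda>\<tau>. 1 / \<tau>) differentiable (at \<tau>)"
      using that by (intro derivative_intros) auto
    ultimately have "((\<lambda>t. E 0 t 0) \<circ> (\<lambda>\<tau>. 1 / \<tau>)) differentiable (at \<tau>)"
      by (intro differentiable_chain_at) auto
    moreover have "(ln :: real \<Rightarrow> real) differentiable (at \<tau>)"
      using DERIV_ln[OF that] real_differentiable_def by blast
    ultimately show ?thesis unfolding m_def o_def
      by (intro differentiable_add differentiable_mult differentiable_const) auto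
  qed
  have "m (y + z) - m y = m z - K 1" if "y > 0" "z > 0" for y z
    using mK[OF that] K[of "z / (y * (y + z))" 1] that by simp
  then obtain \<nu> C where "\<And>t. t > 0 \<Longrightarrow> m t = \<nu> * t + C"
    using affine_if_increments_translation_invariant[OF dm, of "\<lambda>z. m z - K 1"] by metis
  thus ?thesis using that[of \<nu> C] by (simp add: m_def eq_diff_eq)
qed

text \<open>
  The endpoint \<open>a = 0\<close> determines \<open>E 0 t b\<close>. There the time \<open>s * t / (t - s)\<close> of the middle density equals
  \<open>t\<^sup>2 / u - t\<close> with \<open>u = t - s\<close>, so comparing two values of \<open>u\<close> shows that \<open>t\<^sup>2 * c (b /\<^sub>R t powr \<alpha>)\<close> is
  independent of \<open>t\<close>: this is the homogeneity of \<open>c\<close>. The terms without \<open>u\<close> then express \<open>E 0 t b\<close>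
  by its value at \<open>b = 0\<close>, up to a function of \<open>b\<close> and one of \<open>b /\<^sub>R t powr \<alpha>\<close>. After all of this is
  inserted into the full equation, the only term that still contains \<open>t\<close> is
  \<open>\<psi> (b /\<^sub>R t powr \<alpha>) (t powr \<alpha> *\<^sub>R a /\<^sub>R u powr \<alpha>)\<close>, and its independence of \<open>t\<close> is the scaling invariance
  of \<open>\<psi>\<close>.
\<close>

lemma log_density_decomposition:
  obtains \<nu> C c g \<psi> where
    "\<And>t x y. t > 0 \<Longrightarrow> E x (1 / t) (y /\<^sub>R t powr \<alpha>) =
       \<nu> * t + C - N / 2 * ln t + (c x + c y) / t + g x - g y + \<psi> x (y /\<^sub>R t powr \<alpha>)"
    "\<And>r x. r > 0 \<Longrightarrow> c (r *\<^sub>R x) = r powr (2 / \<alpha>) * c x"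
    "\<And>r x y. r > 0 \<Longrightarrow> \<psi> (r *\<^sub>R x) y = \<psi> x (r *\<^sub>R y)"
    "\<And>x. \<psi> x 0 = 0"
proof -
  obtain c G where E: "\<And>x t b. t > 0 \<Longrightarrow> E x t b = E 0 t b + c x * t + G x b"
    and c0: "c 0 = 0" and G0: "\<And>b. G 0 b = 0"
    using starting_point_dependence by blast
  obtain \<nu> C where m: "\<And>t. t > 0 \<Longrightarrow> E 0 (1 / t) 0 = \<nu> * t + C - N / 2 * ln t"
    using diagonal_value by blast
  define g where "g x = G x 0" for x
  define K where "K u b = R 0 u 0 b - R 0 u 0 0" for u b
  have K: "E 0 t b - E 0 t 0 + c (b /\<^sub>R t powr \<alpha>) * (t\<^sup>2 / u - t) + g (b /\<^sub>R t powr \<alpha>) = K u b"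
    if "0 < u" "u < t" for t u b
  proof -
    have p: "0 < t - u" "t - u < t" "(t - u) * t / u > 0" using that by auto
    have "(t - u) * t / u = t\<^sup>2 / u - t" using that by (simp add: field_simps power2_eq_square)
    thus ?thesis
      using hom[OF p(1,2), of 0 b 0] hom[OF p(1,2), of 0 0 0]
        E[OF p(3), of "b /\<^sub>R t powr \<alpha>" 0]
      by (simp add: K_def g_def)
  qed
  \<comment> \<open>The equation \<open>K\<close> needs \<open>u < t\<close>; two values of \<open>u\<close> below both \<open>t\<close> and \<open>1\<close> allow the comparison of
    the times \<open>t\<close> and \<open>1\<close>.\<close>
  have cs: "c (b /\<^sub>R t powr \<alpha>) = c b / t\<^sup>2" if t: "t > 0" for t b
  proof -
    define u v where "u = min t 1 / 3" and "v = min t 1 / 2"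
    have uv: "0 < u" "u < t" "u < 1" "0 < v" "v < t" "v < 1" "u < v"
      using t by (auto simp: u_def v_def)
    have inv: "1 / u - 1 / v \<noteq> 0" using uv by (simp add: frac_less2)
    have "c (b /\<^sub>R t powr \<alpha>) * t\<^sup>2 * (1 / u - 1 / v) = K u b - K v b"
      using K[of u t b] K[of v t b] uv by (simp add: algebra_simps)
    moreover have "c b * (1 / u - 1 / v) = K u b - K v b"
      using K[of u 1 b] K[of v 1 b] uv by (simp add: algebra_simps)
    ultimately have "c (b /\<^sub>R t powr \<alpha>) * t\<^sup>2 = c b" using inv by (metis mult_right_cancel)
    thus ?thesis using t by (simp add: eq_divide_eq)
  qed
  define k where "k b = E 0 1 b - E 0 1 0 - c b + g b" for b
  have E0: "E 0 t b = E 0 t 0 + c b / t - g (b /\<^sub>R t powr \<alpha>) + k b" if t: "t > 0" for t b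
  proof -
    define u where "u = min t 1 / 2"
    have u: "0 < u" "u < t" "u < 1" using t by (auto simp: u_def)
    have "c (b /\<^sub>R t powr \<alpha>) * (t\<^sup>2 / u - t) = c b / u - c b / t"
      unfolding cs[OF t] using t u by (simp add: field_simps power2_eq_square)
    moreover have "c b * (1 / u - 1) = c b / u - c b" by (simp add: algebra_simps)
    ultimately show ?thesis
      using K[of u t b] K[of u 1 b] u by (simp add: k_def)
  qed
  have sc: "z /\<^sub>R t powr \<alpha> /\<^sub>R (1 / t) powr \<alpha> = z" if "t > 0" for z :: 'a and t
    using that by (simp add: powr_divide)
  define \<psi> where "\<psi> x y = G x y + k y - g x" for x y
  have k0: "k 0 = 0" using c0 G0 by (simp add: k_def g_def)
  show ?thesis
  proof (rule that[of \<nu> C c g \<psi>])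
    fix t :: real and x y :: 'a assume t: "t > 0"
    have "c (y /\<^sub>R t powr \<alpha>) * t = c y / t"
      using t by (simp add: cs power2_eq_square)
    thus "E x (1 / t) (y /\<^sub>R t powr \<alpha>) =
       \<nu> * t + C - N / 2 * ln t + (c x + c y) / t + g x - g y + \<psi> x (y /\<^sub>R t powr \<alpha>)"
      using t E[of "1 / t" x "y /\<^sub>R t powr \<alpha>"] E0[of "1 / t" "y /\<^sub>R t powr \<alpha>"] m[OF t] sc[OF t, of y]
      by (simp add: \<psi>_def add_divide_distrib)
  next
    fix r :: real and x :: 'a assume r: "r > 0"
    define t where "t = r powr (- (1 / \<alpha>))"
    have "t > 0" using r by (simp add: t_def)
    moreover have "t powr \<alpha> = inverse r" unfolding t_def powr_powr using r \<alpha> by (simp add: powr_minus)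
    moreover have "1 / t\<^sup>2 = r powr (2 / \<alpha>)"
    proof -
      have "t\<^sup>2 = r powr (- (2 / \<alpha>))"
        unfolding t_def power2_eq_square powr_add[symmetric] by simp
      thus ?thesis by (simp add: powr_minus divide_inverse)
    qed
    ultimately
    show "c (r *\<^sub>R x) = r powr (2 / \<alpha>) * c x" using cs[of t x] by (simp add: divide_inverse mult.commute)
  next
    fix r :: real and x y :: 'a assume r: "r > 0"
    define t where "t = r powr (1 / \<alpha>)"
    have t: "t > 0" "t powr \<alpha> = r" using r \<alpha> by (simp_all add: t_def powr_powr)
    define u where "u = min t 1 / 2"
    have u: "0 < u" "u < t" "u < 1" using t by (auto simp: u_def)
    define a where "a = u powr \<alpha> *\<^sub>R y"
    define b where "b = r *\<^sub>R x"
    \<comment> \<open>With these \<open>a\<close>, \<open>b\<close> and \<open>u\<close> the two sides of the claim are the values of the left-hand side below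
      at the times \<open>1\<close> and \<open>r powr (1 / \<alpha>)\<close>, whereas the right-hand side does not contain the time.\<close>
    have \<psi>: "\<psi> (b /\<^sub>R t powr \<alpha>) (t powr \<alpha> *\<^sub>R a /\<^sub>R u powr \<alpha>)
        = R 0 u a b - (c a + c b) / u - k b + k a - C + N / 2 * ln u"
      if t: "u < t" for t
    proof -
      have t0: "t > 0" using t u by simp
      define s where "s = t - u"
      have s: "0 < s" "s < t" "t - s = u" using t u by (auto simp: s_def)
      have st: "s * t / u > 0" using s u t0 by simp
      let ?w = "t powr \<alpha> *\<^sub>R a /\<^sub>R u powr \<alpha>"
      have w: "?w /\<^sub>R (s * t / u) powr \<alpha> = a /\<^sub>R s powr \<alpha>"
      proof -
        have "t powr \<alpha> * inverse (u powr \<alpha>) * inverse ((s * t / u) powr \<alpha>) = inverse (s powr \<alpha>)"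
          using s t0 u by (simp add: powr_divide powr_mult divide_simps)
        thus ?thesis by (simp add: mult_ac)
      qed
      have w': "?w = a /\<^sub>R (u / t) powr \<alpha>"
      proof -
        have "(u / t) powr \<alpha> = u powr \<alpha> / t powr \<alpha>" using t0 u by (simp add: powr_divide)
        thus ?thesis by (simp add: mult.commute divide_inverse)
      qed
      have cw: "c ?w / (s * t / u) = c a * t / (s * u)"
      proof -
        have "c ?w = c a / (u / t)\<^sup>2" unfolding w' using cs[of "u / t" a] u t0 by simp
        thus ?thesis using u t0 s by (simp add: divide_simps power2_eq_square)
      qed
      have cb: "c (b /\<^sub>R t powr \<alpha>) * (s * t / u) = c b * s / (t * u)"
        using cs[OF t0, of b] t0 by (simp add: power2_eq_square)
      have m1: "E 0 r 0 = \<nu> / r + C + N / 2 * ln r" if "r > 0" for r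
        using m[of "1 / r"] that by (simp add: ln_div)
      have lnst: "N / 2 * ln (s * t / u) = N / 2 * ln s + N / 2 * ln t - N / 2 * ln u"
      proof -
        have "ln (s * t / u) = ln s + ln t - ln u"
          using s(1) t0 u by (simp add: ln_div ln_mult)
        thus ?thesis by (simp only: right_diff_distrib distrib_left)
      qed
      have cab: "(c a + c b) / u = c a / u + c b / u" by (rule add_divide_distrib)
      have lnt: "- N * ln t = - (N / 2 * ln t) - N / 2 * ln t" by simp
      have c1: "c b / t + c b * s / (t * u) = c b / u" 
        using s t0 u by (simp add: divide_simps) (simp add: s_def algebra_simps)
      have c2: "c a * t / (s * u) - c a / s = c a / u"
        using s t0 u by (simp add: divide_simps) (simp add: s_def algebra_simps)
      have c3: "\<nu> / t - \<nu> / s + \<nu> / (s * t / u) = 0"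
        using s t0 u by (simp add: divide_simps) (simp add: s_def algebra_simps)
      have "- N * ln t + E 0 t b - E 0 s a + E (b /\<^sub>R t powr \<alpha>) (s * t / u) ?w = R 0 u a b"
        using hom[OF s(1,2), of 0 b a] s(3) by simp
      moreover have "E (b /\<^sub>R t powr \<alpha>) (s * t / u) ?w =
          E 0 (s * t / u) 0 + c a * t / (s * u) - g (a /\<^sub>R s powr \<alpha>) + k ?w
            + c b * s / (t * u) + G (b /\<^sub>R t powr \<alpha>) ?w"
        using E[OF st, of "b /\<^sub>R t powr \<alpha>" ?w] E0[OF st, of ?w] unfolding cb cw w by simp
      ultimately show ?thesis
        using E0[OF t0, of b] E0[OF s(1), of a] m1[OF t0] m1[OF s(1)] m1[OF st] lnst c1 c2 c3 cab lnt
        unfolding \<psi>_def by linarith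
    qed
    have "t powr \<alpha> *\<^sub>R a /\<^sub>R u powr \<alpha> = r *\<^sub>R y" "1 powr \<alpha> *\<^sub>R a /\<^sub>R u powr \<alpha> = y"
      "b /\<^sub>R t powr \<alpha> = x" "b /\<^sub>R 1 powr \<alpha> = r *\<^sub>R x"
      using u r by (simp_all add: a_def b_def t(2))
    thus "\<psi> (r *\<^sub>R x) y = \<psi> x (r *\<^sub>R y)" using \<psi>[OF u(2)] \<psi>[OF u(3)] by simp
  next
    fix x show "\<psi> x 0 = 0" by (simp add: \<psi>_def k0 g_def)
  qed
qed

end

section \<open>Twice differentiable functions\<close>

lemma differentiable_on_if_has_derivative:
  assumes "\<And>z. z \<in> U \<Longrightarrow> (f has_derivative f' z) (at z)"
  shows "f differentiable_on U"
  unfolding differentiable_on_def differentiable_def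
  using has_derivative_at_withinI[OF assms] by blast

lemma twice_differentiable_on_cong:
  assumes "open U" "\<And>z. z \<in> U \<Longrightarrow> f z = g z"
  shows "twice_differentiable_on f U \<longleftrightarrow> twice_differentiable_on g U"
proof -
  have "(f has_derivative f') (at z) \<longleftrightarrow> (g has_derivative f') (at z)" if "z \<in> U" for z f'
    using has_derivative_transform_within_open[OF _ assms(1) that] assms(2) by metis
  thus ?thesis unfolding twice_differentiable_on_def by simp
qed

lemma twice_differentiable_on_mult:
  assumes "twice_differentiable_on f U" "twice_differentiable_on g U"
  shows "twice_differentiable_on (\<lambda>z. f z * g z) U"
proof -
  obtain f' where f': "\<And>z. z \<in> U \<Longrightarrow> (f has_derivative f' z) (at z)"
    and f'': "\<And>v. (\<lambda>z. f' z v) differentiable_on U"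
    using assms(1) unfolding twice_differentiable_on_def by blast
  obtain g' where g': "\<And>z. z \<in> U \<Longrightarrow> (g has_derivative g' z) (at z)"
    and g'': "\<And>v. (\<lambda>z. g' z v) differentiable_on U"
    using assms(2) unfolding twice_differentiable_on_def by blast
  have d: "f differentiable_on U" "g differentiable_on U"
    by (rule differentiable_on_if_has_derivative, rule f' g', assumption)+
  show ?thesis unfolding twice_differentiable_on_def
    by (rule exI[of _ "\<lambda>z v. f z * g' z v + f' z v * g z"])
      (auto intro!: has_derivative_mult f' g' differentiable_on_add differentiable_on_mult d f'' g'')
qed

lemma twice_differentiable_on_inverse:
  assumes "twice_differentiable_on f U" "\<And>z. z \<in> U \<Longrightarrow> f z \<noteq> 0"
  shows "twice_differentiable_on (\<lambda>z. inverse (f z)) U"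
proof -
  obtain f' where f': "\<And>z. z \<in> U \<Longrightarrow> (f has_derivative f' z) (at z)"
    and f'': "\<And>v. (\<lambda>z. f' z v) differentiable_on U"
    using assms(1) unfolding twice_differentiable_on_def by blast
  have d: "f differentiable_on U"
    by (rule differentiable_on_if_has_derivative[OF f'])
  have i: "(\<lambda>z. inverse (f z)) differentiable_on U"
    using d assms(2) unfolding differentiable_on_def by (blast intro: differentiable_inverse)
  show ?thesis unfolding twice_differentiable_on_def
  proof (intro exI[of _ "\<lambda>z v. - (inverse (f z) * f' z v * inverse (f z))"] conjI ballI allI)
    fix z assume "z \<in> U"
    thus "((\<lambda>z. inverse (f z)) has_derivative (\<lambda>v. - (inverse (f z) * f' z v * inverse (f z)))) (at z)"
      by (intro Deriv.has_derivative_inverse f' assms(2))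
  next
    fix v show "(\<lambda>z. - (inverse (f z) * f' z v * inverse (f z))) differentiable_on U"
      by (intro differentiable_on_minus differentiable_on_mult i f'')
  qed
qed

lemma twice_differentiable_on_affine_compose:
  assumes "bounded_linear L" "twice_differentiable_on f V" "\<And>z. z \<in> U \<Longrightarrow> L z + w \<in> V" "open V"
  shows "twice_differentiable_on (\<lambda>z. f (L z + w)) U"
proof -
  obtain f' where f': "\<And>z. z \<in> V \<Longrightarrow> (f has_derivative f' z) (at z)"
    and f'': "\<And>v. (\<lambda>z. f' z v) differentiable_on V"
    using assms(2) unfolding twice_differentiable_on_def by blast
  have L: "((\<lambda>z. L z + w) has_derivative L) (at z)" for z
    using has_derivative_add_const[OF bounded_linear_imp_has_derivative[OF assms(1)]] .
  have "((\<lambda>z. f (L z + w)) has_derivative (\<lambda>v. f' (L z + w) (L v))) (at z)" if "z \<in> U" for z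
    using has_derivative_compose[OF L f'[OF assms(3)[OF that]]] .
  moreover have "(\<lambda>z. f' (L z + w) (L v)) differentiable_on U" for v
    unfolding differentiable_on_def
  proof
    fix z assume z: "z \<in> U"
    have "(\<lambda>z. f' z (L v)) differentiable (at (L z + w))"
      using f''[of "L v"] assms(3)[OF z] \<open>open V\<close>
      by (simp add: differentiable_on_eq_differentiable_at)
    hence "((\<lambda>z. f' z (L v)) \<circ> (\<lambda>z. L z + w)) differentiable (at z)"
      by (intro differentiable_chain_at differentiableI[OF L])
    thus "(\<lambda>z. f' (L z + w) (L v)) differentiable (at z within U)"
      by (simp add: o_def differentiable_at_withinI)
  qed
  ultimately show ?thesis unfolding twice_differentiable_on_def
    by (intro exI[of _ "\<lambda>z v. f' (L z + w) (L v)"]) auto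
qed

lemma twice_differentiable_on_exp_time:
  "twice_differentiable_on (\<lambda>(t, x, y). K * exp (k * t) :: real)
     (U :: (real \<times> 'a::euclidean_space \<times> 'a) set)"
proof -
  have *: "((\<lambda>z. K * exp (k * fst z)) has_derivative (\<lambda>v. K * (exp (k * fst z) * (k * fst v)))) (at z)"
    for z :: "real \<times> 'a \<times> 'a" and K
    by (auto intro!: derivative_eq_intros)
  have "(\<lambda>z. K * (exp (k * fst z) * (k * fst v))) differentiable_on U" for v :: "real \<times> 'a \<times> 'a"
  proof -
    have "(\<lambda>z. (K * (k * fst v)) * exp (k * fst z)) differentiable_on U"
      by (rule differentiable_on_if_has_derivative[OF *])
    thus ?thesis by (simp add: mult_ac)
  qed
  thus ?thesis unfolding twice_differentiable_on_def case_prod_beta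
    using * by (intro exI[of _ "\<lambda>z v. K * (exp (k * fst z) * (k * fst v))"]) auto
qed

section \<open>Semigroup densities\<close>

context
  fixes p :: "real \<Rightarrow> real^'n \<Rightarrow> real^'n \<Rightarrow> real"
  assumes p: "semigroup_densities p"
begin

lemma semigroup_densities_pos: "t > 0 \<Longrightarrow> p t x y > 0"
  using p unfolding semigroup_densities_def by (elim conjE) simp

lemma semigroup_densities_differentiable:
  assumes "t > 0"
  shows "(\<lambda>(t, x, y). p t x y) differentiable (at (t, x, y))"
proof -
  obtain p' where "\<forall>z\<in>{0<..} \<times> UNIV \<times> UNIV. ((\<lambda>(t, x, y). p t x y) has_derivative p' z) (at z)"
    using p unfolding semigroup_densities_def twice_differentiable_on_def by (elim conjE exE)
  hence "((\<lambda>(t, x, y). p t x y) has_derivative p' (t, x, y)) (at (t, x, y))"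
    by (rule bspec) (use assms in simp)
  thus ?thesis by (rule differentiableI)
qed

lemma semigroup_densities_borel:
  assumes "t > 0"
  shows "(\<lambda>(x, y). p t x y) \<in> borel_measurable (borel \<Otimes>\<^sub>M borel)"
proof -
  have "isCont (\<lambda>(x, y). p t x y) (x, y)" for x y
  proof -
    have "isCont (\<lambda>(t, x, y). p t x y) (t, x, y)"
      using semigroup_densities_differentiable[OF assms] by (rule differentiable_imp_continuous_within)
    moreover have "isCont (\<lambda>z. (t, z)) (x, y)"
      by (intro continuous_intros)
    ultimately show ?thesis
      using isCont_o2[of "(x, y)" "\<lambda>z. (t, z)" "\<lambda>(t, x, y). p t x y"] by simp
  qed
  hence "continuous_on UNIV (\<lambda>(x, y). p t x y)"
    by (auto intro!: continuous_at_imp_continuous_on)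
  hence "(\<lambda>(x, y). p t x y) \<in> borel_measurable borel"
    by (rule borel_measurable_continuous_onI)
  thus ?thesis by (simp add: borel_prod)
qed

lemma semigroup_densities_measurable_compose:
  assumes "t > 0" "f \<in> borel_measurable M" "g \<in> borel_measurable M"
  shows "(\<lambda>z. p t (f z) (g z)) \<in> borel_measurable M"
  using measurable_compose[OF measurable_Pair[OF assms(2,3)] semigroup_densities_borel[OF assms(1)]]
  by simp

lemma semigroup_densities_nn_integral_1:
  assumes "t > 0"
  shows "(\<integral>\<^sup>+y. ennreal (p t x y) \<partial>lborel) = 1"
proof -
  have i: "(LINT y|lborel. p t x y) = 1"
    using p assms unfolding semigroup_densities_def by (elim conjE) simp
  hence "integrable lborel (p t x)" using not_integrable_integral_eq by fastforce
  from nn_integral_eq_integral[OF this] i show ?thesis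
    using semigroup_densities_pos[OF assms] by (simp add: less_imp_le)
qed

lemma semigroup_densities_nn_Chapman_Kolmogorov:
  assumes "s > 0" "t > 0"
  shows "(\<integral>\<^sup>+y. ennreal (p s x y) * ennreal (p t y z) \<partial>lborel) = ennreal (p (s + t) x z)"
proof -
  have i: "p (s + t) x z = (LINT y|lborel. p s x y * p t y z)"
    using p assms unfolding semigroup_densities_def by (elim conjE) simp
  moreover have "p (s + t) x z > 0" using assms by (intro semigroup_densities_pos) simp
  ultimately have "integrable lborel (\<lambda>y. p s x y * p t y z)"
    using not_integrable_integral_eq by fastforce
  from nn_integral_eq_integral[OF this] i show ?thesis
    using semigroup_densities_pos assms by (simp add: ennreal_mult[symmetric] less_imp_le)
qed

end

section \<open>Undoing the h-transform\<close>

text \<open>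
  Chapman-Kolmogorov with the endpoint \<open>0\<close> reads
  \<open>\<integral> p t x y * exp (c y / s) dy = (s / (t + s)) powr \<kappa> * exp (c x / (t + s))\<close>. As \<open>s \<rightarrow> 0\<close> the right-hand side
  vanishes, although the integrand does not decrease where \<open>c\<close> is positive; hence \<open>c \<le> 0\<close> almost
  everywhere. As \<open>s \<rightarrow> \<infinity>\<close> the integrand therefore increases to \<open>p t x y\<close>, and the right-hand side tends
  to \<open>1\<close>.
\<close>

lemma Chapman_Kolmogorov_total_mass_one:
  fixes p :: "real \<Rightarrow> 'a::euclidean_space \<Rightarrow> 'a \<Rightarrow> real" and c :: "'a \<Rightarrow> real"
  assumes pos: "\<And>t x y. t > 0 \<Longrightarrow> p t x y > 0"
    and meas: "\<And>t x. t > 0 \<Longrightarrow> p t x \<in> borel_measurable borel"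
    and CK: "\<And>s t x z. s > 0 \<Longrightarrow> t > 0 \<Longrightarrow>
        (\<integral>\<^sup>+y. ennreal (p s x y) * ennreal (p t y z) \<partial>lborel) = ennreal (p (s + t) x z)"
    and c[measurable]: "c \<in> borel_measurable borel"
    and "C > 0" "\<kappa> > 0"
    and zero: "\<And>t x. t > 0 \<Longrightarrow> p t x 0 = C * t powr (- \<kappa>) * exp (c x / t)"
    and "t > 0"
  shows "(\<integral>\<^sup>+y. ennreal (p t x y) \<partial>lborel) = 1"
proof -
  note meas[measurable]
  have int: "(\<integral>\<^sup>+y. ennreal (p t x y) * ennreal (exp (c y / s)) \<partial>lborel)
      = ennreal ((s / (t + s)) powr \<kappa> * exp (c x / (t + s)))" if "s > 0" "t > 0" for s t x
  proof -
    have [measurable]: "p t x \<in> borel_measurable borel" using meas that by simp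
    have e: "C * s powr (- \<kappa>) > 0" using \<open>C > 0\<close> that by simp
    have "ennreal (C * s powr (- \<kappa>)) * (ennreal (p t x y) * ennreal (exp (c y / s))) =
        ennreal (p t x y) * ennreal (p s y 0)" for y
      using e unfolding zero[OF that(1)] by (subst ennreal_mult') (simp_all add: mult_ac)
    hence "ennreal (C * s powr (- \<kappa>)) * (\<integral>\<^sup>+y. ennreal (p t x y) * ennreal (exp (c y / s)) \<partial>lborel) =
        (\<integral>\<^sup>+y. ennreal (p t x y) * ennreal (p s y 0) \<partial>lborel)"
      by (subst nn_integral_cmult[symmetric]) auto
    also have "\<dots> = ennreal (C * (t + s) powr (- \<kappa>) * exp (c x / (t + s)))"
      unfolding CK[OF that(2,1)] using that by (simp add: zero)
    also have "C * (t + s) powr (- \<kappa>) * exp (c x / (t + s)) =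
        (C * s powr (- \<kappa>)) * ((s / (t + s)) powr \<kappa> * exp (c x / (t + s)))"
      using that by (simp add: powr_divide powr_minus field_simps)
    also have "ennreal \<dots> = ennreal (C * s powr (- \<kappa>)) * ennreal ((s / (t + s)) powr \<kappa> * exp (c x / (t + s)))"
      using e by (intro ennreal_mult) auto
    finally show ?thesis using e that \<open>C > 0\<close> by (auto simp: ennreal_mult_cancel_left)
  qed
  have AE_c: "AE y in lborel. c y \<le> 0"
  proof -
    let ?w = "\<lambda>y. ennreal (p 1 0 y)"
    have [measurable]: "p 1 0 \<in> borel_measurable borel" using meas by simp
    define A where "A = (\<integral>\<^sup>+y. ?w y * indicator {y. c y > 0} y \<partial>lborel)"
    have le: "A \<le> ennreal ((s / (1 + s)) powr \<kappa> * exp (c 0 / (1 + s)))" if "s > 0" for s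
    proof -
      have "A \<le> (\<integral>\<^sup>+y. ?w y * ennreal (exp (c y / s)) \<partial>lborel)"
        unfolding A_def using that
        by (intro nn_integral_mono mult_left_mono)
           (auto simp: indicator_def)
      thus ?thesis using int[OF that, of 1 0] by simp
    qed
    have "((\<lambda>s. (s / (1 + s)) powr \<kappa> * exp (c 0 / (1 + s))) \<longlongrightarrow> 0) (at_right 0)"
      using \<open>\<kappa> > 0\<close> by real_asymp
    hence "((\<lambda>s. ennreal ((s / (1 + s)) powr \<kappa> * exp (c 0 / (1 + s)))) \<longlongrightarrow> ennreal 0) (at_right 0)"
      by (rule tendsto_ennrealI)
    hence "A \<le> ennreal 0"
      by (rule tendsto_lowerbound) (auto intro!: eventually_mono[OF eventually_at_right_less[of "0::real"]] le)
    hence "A = 0" by simp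
    hence "AE y in lborel. ?w y * indicator {y. c y > 0} y = 0"
      unfolding A_def by (subst (asm) nn_integral_0_iff_AE) auto
    thus ?thesis
    proof (rule eventually_mono)
      fix y assume "?w y * indicator {y. c y > 0} y = 0"
      moreover have "?w y \<noteq> 0" using pos[of 1 0 y] by simp
      ultimately show "c y \<le> 0" by (simp add: indicator_eq_0_iff not_less)
    qed
  qed
  have [measurable]: "p t x \<in> borel_measurable borel" using meas \<open>t > 0\<close> by simp
  \<comment> \<open>Truncating \<open>c\<close> at \<open>0\<close> changes it on a null set and makes the convergence monotone at every point.\<close>
  let ?F = "\<lambda>k y. ennreal (p t x y * exp (min (c y) 0 / real (Suc k)))"
  have "(\<lambda>k. \<integral>\<^sup>+y. ?F k y \<partial>lborel) \<longlonglongrightarrow> (\<integral>\<^sup>+y. ennreal (p t x y) \<partial>lborel)"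
  proof (rule nn_integral_LIMSEQ)
    show "incseq ?F"
    proof (intro incseq_SucI le_funI ennreal_leI mult_left_mono)
      fix k y
      show "exp (min (c y) 0 / real (Suc k)) \<le> exp (min (c y) 0 / real (Suc (Suc k)))"
        by (simp add: divide_left_mono_neg)
      show "0 \<le> p t x y" using pos[OF \<open>t > 0\<close>] by (simp add: less_imp_le)
    qed
    fix y
    have "(\<lambda>k. min (c y) 0 / real (Suc k)) \<longlonglongrightarrow> 0"
      using lim_const_over_n[of "min (c y) 0"] by (rule LIMSEQ_Suc)
    hence "(\<lambda>k. p t x y * exp (min (c y) 0 / real (Suc k))) \<longlonglongrightarrow> p t x y * exp 0"
      by (intro tendsto_intros)
    thus "(\<lambda>k. ?F k y) \<longlonglongrightarrow> ennreal (p t x y)" by (intro tendsto_ennrealI) simp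
  qed measurable
  moreover have "(\<integral>\<^sup>+y. ?F k y \<partial>lborel) =
      ennreal ((real (Suc k) / (t + real (Suc k))) powr \<kappa> * exp (c x / (t + real (Suc k))))" for k
  proof -
    have "(\<integral>\<^sup>+y. ?F k y \<partial>lborel) =
        (\<integral>\<^sup>+y. ennreal (p t x y) * ennreal (exp (c y / real (Suc k))) \<partial>lborel)"
      using AE_c pos[OF \<open>t > 0\<close>]
      by (intro nn_integral_cong_AE) (auto elim!: eventually_mono simp: ennreal_mult less_imp_le min_def)
    thus ?thesis using int[of "real (Suc k)" t x] \<open>t > 0\<close> by simp
  qed
  moreover have "(\<lambda>k. ennreal ((real (Suc k) / (t + real (Suc k))) powr \<kappa> *
      exp (c x / (t + real (Suc k))))) \<longlonglongrightarrow> ennreal 1"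
    by (intro tendsto_ennrealI) real_asymp
  ultimately show ?thesis using LIMSEQ_unique by fastforce
qed

text \<open>
  The known values at \<open>y = 0\<close> express \<open>G\<close> through \<open>p\<close>: in \<open>p 2 x 0 * p 2 x 0 / p 1 x 0\<close> the exponentials
  \<open>exp (c x / 2) * exp (c x / 2)\<close> and \<open>exp (c x)\<close> cancel, and one factor \<open>G x\<close> is left. So \<open>G\<close> inherits the regularity
  of \<open>p\<close>, and \<open>p'\<close> is twice differentiable. Its total mass is the subject of the previous lemma; the
  Chapman-Kolmogorov equation carries over because the quotients of \<open>G\<close> telescope.
\<close>

lemma semigroup_densities_of_h_transform:
  fixes p p' :: "real \<Rightarrow> real^'n \<Rightarrow> real^'n \<Rightarrow> real" and c G :: "real^'n \<Rightarrow> real"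
  assumes p: "semigroup_densities p"
    and G: "\<And>x. G x > 0"
    and rel: "\<And>t x y. t > 0 \<Longrightarrow> p t x y = exp (\<nu> * t) * (G x / G y) * p' t x y"
    and "C > 0" "\<kappa> > 0"
    and zero: "\<And>t x. t > 0 \<Longrightarrow> p' t x 0 = C * t powr (- \<kappa>) * exp (c x / t)"
  shows "semigroup_densities p'"
proof -
  note pos = semigroup_densities_pos[OF p]
  let ?U = "{0<..} \<times> UNIV \<times> UNIV :: (real \<times> (real^'n) \<times> (real^'n)) set"
  have U: "open ?U" by (intro open_Times) auto
  define w where "w x = p 2 x 0 * p 2 x 0 * inverse (p 1 x 0)" for x
  define K where "K = G 0 * exp (- 3 * \<nu>) / C * 2 powr (2 * \<kappa>)"
  have K: "K > 0" using G[of 0] \<open>C > 0\<close> by (simp add: K_def)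
  have Gw: "G x = K * w x" for x
  proof -
    define q where "q = (2::real) powr (2 * \<kappa>)"
    have e: "exp (c x / 2) * exp (c x / 2) = exp (c x)"
      "exp (\<nu> * 2) * exp (\<nu> * 2) = exp \<nu> * exp (3 * \<nu>)"
      by (simp_all add: exp_add[symmetric])
    have e': "2 powr (- \<kappa>) * 2 powr (- \<kappa>) = inverse q"
      unfolding q_def by (simp add: powr_add[symmetric] powr_minus[symmetric])
    have "w x = (exp (\<nu> * 2) * exp (\<nu> * 2)) * (2 powr (- \<kappa>) * 2 powr (- \<kappa>)) *
        (exp (c x / 2) * exp (c x / 2)) * (G x / G 0) * C / (exp \<nu> * exp (c x))"
      using G[of x] G[of 0] \<open>C > 0\<close> by (simp add: w_def rel zero field_simps)
    hence "w x = exp (3 * \<nu>) * inverse q * (G x / G 0) * C"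
      unfolding e e' by simp
    moreover have "q > 0" by (simp add: q_def)
    ultimately show ?thesis
      using G[of x] G[of 0] \<open>C > 0\<close>
      unfolding K_def q_def[symmetric] by (simp add: exp_minus field_simps)
  qed
  have w: "w x > 0" for x using G[of x] K by (simp add: Gw zero_less_mult_iff)
  have p': "p' t x y = exp (- \<nu> * t) * (w y * inverse (w x)) * p t x y" if "t > 0" for t x y
    using w[of x] w[of y] K that by (simp add: rel Gw exp_minus field_simps)
  have pos': "p' t x y > 0" if "t > 0" for t x y
    using w pos[OF that] by (simp add: p'[OF that])
  have meas: "p' t x \<in> borel_measurable borel" if "t > 0" for t x
  proof -
    have [measurable]: "(\<lambda>y. p t x y) \<in> borel_measurable borel" if "t > 0" for t x
      using that by (intro semigroup_densities_measurable_compose[OF p]) auto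
    have [measurable]: "(\<lambda>y. p t y 0) \<in> borel_measurable borel" if "t > 0" for t
      using that by (intro semigroup_densities_measurable_compose[OF p]) auto
    have [measurable]: "w \<in> borel_measurable borel" unfolding w_def by measurable
    show ?thesis using that unfolding p'[OF that, abs_def] by measurable
  qed
  have nnCK: "(\<integral>\<^sup>+y. ennreal (p' s x y) * ennreal (p' t y z) \<partial>lborel) = ennreal (p' (s + t) x z)"
    if st: "s > 0" "t > 0" for s t x z
  proof -
    define k where "k = exp (- \<nu> * (s + t)) * (w z * inverse (w x))"
    have k: "k > 0" using w by (simp add: k_def)
    have "p' s x y * p' t y z = k * (p s x y * p t y z)" for y
      using w[of y] st by (simp add: p' k_def exp_add[symmetric] algebra_simps)
    hence "ennreal (p' s x y) * ennreal (p' t y z) = ennreal k * (ennreal (p s x y) * ennreal (p t y z))" for y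
      using pos'[OF st(1)] pos'[OF st(2)] pos[OF st(1)] pos[OF st(2)] k
      by (simp add: ennreal_mult[symmetric] less_imp_le)
    moreover have "(\<lambda>y. ennreal (p s x y) * ennreal (p t y z)) \<in> borel_measurable lborel"
      using st by (intro borel_measurable_times_ennreal measurable_compose[OF _ measurable_ennreal]
          semigroup_densities_measurable_compose[OF p]) auto
    ultimately have "(\<integral>\<^sup>+y. ennreal (p' s x y) * ennreal (p' t y z) \<partial>lborel) = ennreal k * ennreal (p (s + t) x z)"
      using semigroup_densities_nn_Chapman_Kolmogorov[OF p st] by (simp add: nn_integral_cmult)
    also have "\<dots> = ennreal (p' (s + t) x z)"
      using k st by (simp add: ennreal_mult'[symmetric] p' k_def)
    finally show ?thesis .
  qed
  have "c = (\<lambda>y. ln (p' 1 y 0 / C))"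
    using \<open>C > 0\<close> by (simp add: zero fun_eq_iff)
  moreover have "(\<lambda>y. p' 1 y 0) \<in> borel_measurable borel"
  proof -
    have [measurable]: "(\<lambda>y. p t y 0) \<in> borel_measurable borel" if "t > 0" for t
      using that by (intro semigroup_densities_measurable_compose[OF p]) auto
    have [measurable]: "w \<in> borel_measurable borel" unfolding w_def by measurable
    show ?thesis by (simp add: p')
  qed
  ultimately have c: "c \<in> borel_measurable borel" by simp
  have mass: "(\<integral>\<^sup>+y. ennreal (p' t x y) \<partial>lborel) = 1" if "t > 0" for t x
    by (rule Chapman_Kolmogorov_total_mass_one[OF pos' meas nnCK c \<open>C > 0\<close> \<open>\<kappa> > 0\<close> zero that])
  show ?thesis unfolding semigroup_densities_def
  proof (intro conjI allI impI)
    show "p' t x y > 0" if "t > 0" for t x y by (rule pos'[OF that])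
  next
    fix t :: real and x assume t: "t > 0"
    show "(LINT y|lborel. p' t x y) = 1"
      using mass[OF t, of x] meas[OF t, of x] pos'[OF t, of x]
      by (subst integral_eq_nn_integral) (auto simp: less_imp_le)
  next
    fix s t :: real and x z assume st: "s > 0" "t > 0"
    have 1: "(\<lambda>y. p' s x y * p' t y z) \<in> borel_measurable lborel"
    proof -
      have [measurable]: "(\<lambda>y. p t y z) \<in> borel_measurable borel" if "t > 0" for t z
        using that by (intro semigroup_densities_measurable_compose[OF p]) auto
      have [measurable]: "w \<in> borel_measurable borel" unfolding w_def by measurable
      have [measurable]: "p' s x \<in> borel_measurable borel" by (rule meas[OF st(1)])
      show ?thesis using st by (simp add: p'[OF st(2)])
    qed
    show "p' (s + t) x z = (LINT y|lborel. p' s x y * p' t y z)"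
      using nnCK[OF st, of x z] 1 pos'[OF st(1), of x] pos'[OF st(2)] pos'[of "s + t" x z] st
      by (subst integral_eq_nn_integral) (auto simp: less_imp_le ennreal_mult)
  next
    have td: "twice_differentiable_on (\<lambda>(t, x, y). p t x y) ?U"
      using p unfolding semigroup_densities_def by (elim conjE)
    have at0: "twice_differentiable_on (\<lambda>z. p r (L z) 0) ?U" if "r > 0" "bounded_linear L" for r and L :: "_ \<Rightarrow> real^'n"
    proof -
      have "bounded_linear (\<lambda>z. (0::real, L z, 0 :: real^'n))"
        using that(2) by (intro bounded_linear_Pair bounded_linear_zero)
      from twice_differentiable_on_affine_compose[OF this td, of ?U "(r, 0, 0)"] U that(1)
      show ?thesis by simp
    qed
    have w2: "twice_differentiable_on (\<lambda>z. w (L z)) ?U" if "bounded_linear L" for L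
      unfolding w_def using pos[of 1]
      by (intro twice_differentiable_on_mult twice_differentiable_on_inverse at0 U that)
         (auto simp: less_imp_neq[symmetric] less_imp_le)
    have "twice_differentiable_on (\<lambda>z. (case z of (t, x, y) \<Rightarrow> 1 * exp (- \<nu> * t)) *
        (w (snd (snd z)) * inverse (w (fst (snd z)))) * (case z of (t, x, y) \<Rightarrow> p t x y)) ?U"
      using w by (intro twice_differentiable_on_mult twice_differentiable_on_inverse w2 U td
          twice_differentiable_on_exp_time bounded_linear_snd_comp bounded_linear_fst_comp bounded_linear_snd)
         (auto simp: less_imp_neq[symmetric])
    thus "twice_differentiable_on (\<lambda>(t, x, y). p' t x y) ?U"
    proof (rule twice_differentiable_on_cong[OF U, THEN iffD1, rotated])
      fix z :: "real \<times> (real^'n) \<times> (real^'n)" assume "z \<in> ?U"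
      thus "(case z of (t, x, y) \<Rightarrow> 1 * exp (- \<nu> * t)) *
        (w (snd (snd z)) * inverse (w (fst (snd z)))) * (case z of (t, x, y) \<Rightarrow> p t x y) =
        (case z of (t, x, y) \<Rightarrow> p' t x y)" by (auto simp: p')
    qed
  qed
qed

section \<open>Markov processes run backwards\<close>

lemma
  shows sets_natural_filtration: "sets (natural_filtration M T Y s) =
      sigma_sets (space M) (\<Union>u\<in>{u\<in>T. u \<le> s}. {Y u -` A \<inter> space M | A. A \<in> sets borel})"
    and space_natural_filtration: "space (natural_filtration M T Y s) = space M"
  unfolding natural_filtration_def by (subst sets_measure_of space_measure_of; auto)+

lemma natural_filtration_measurable:
  assumes "u \<in> T" "u \<le> s"
  shows "Y u \<in> borel_measurable (natural_filtration M T Y s)"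
proof (rule measurableI)
  fix A :: "(real^'b) set" assume "A \<in> sets borel"
  thus "Y u -` A \<inter> space (natural_filtration M T Y s) \<in> sets (natural_filtration M T Y s)"
    using assms unfolding sets_natural_filtration space_natural_filtration
    by (intro sigma_sets.Basic) auto
qed simp

lemma subalgebra_natural_filtration:
  assumes "\<And>u. u \<in> T \<Longrightarrow> Y u \<in> borel_measurable M"
  shows "subalgebra M (natural_filtration M T Y s)"
  unfolding subalgebra_def space_natural_filtration sets_natural_filtration
  using assms by (auto intro!: sets.sigma_sets_subset measurable_sets)

lemma natural_filtration_mono:
  assumes "s \<le> t"
  shows "subalgebra (natural_filtration M T Y t) (natural_filtration M T Y s)"
  unfolding subalgebra_def space_natural_filtration sets_natural_filtration
  using assms by (intro conjI refl sigma_sets_subseteq UN_mono) auto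

context
  fixes M :: "'w measure" and T :: "real set" and X :: "real \<Rightarrow> 'w \<Rightarrow> real^'n"
    and q :: "real \<Rightarrow> real \<Rightarrow> real^'n \<Rightarrow> real^'n \<Rightarrow> real"
  assumes markov: "markov_with_densities M T X q"
    and q_nonneg: "\<And>s t a b. s \<in> T \<Longrightarrow> t \<in> T \<Longrightarrow> s < t \<Longrightarrow> q s t a b \<ge> 0"
    and q_finite: "\<And>s t a. s \<in> T \<Longrightarrow> t \<in> T \<Longrightarrow> s < t \<Longrightarrow> (\<integral>\<^sup>+b. ennreal (q s t a b) \<partial>lborel) < \<infinity>"
begin

private lemma prob_space_M: "prob_space M"
  using markov unfolding markov_with_densities_def by simp

private lemma X_measurable [measurable]: "t \<in> T \<Longrightarrow> X t \<in> borel_measurable M"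
  using markov unfolding markov_with_densities_def by simp

private lemma q_measurable:
  "s \<in> T \<Longrightarrow> t \<in> T \<Longrightarrow> s < t \<Longrightarrow> (\<lambda>(a, b). q s t a b) \<in> borel_measurable (borel \<Otimes>\<^sub>M borel)"
  using markov unfolding markov_with_densities_def by simp

private lemma subalgebra_X: "subalgebra M (natural_filtration M T X s)"
  by (rule subalgebra_natural_filtration) (rule X_measurable)

private lemma transition_indicator:
  assumes st: "s \<in> T" "t \<in> T" "s < t"
    and \<psi>: "\<psi> \<in> borel_measurable (natural_filtration M T X s)" and A: "A \<in> sets borel"
  shows "(\<integral>\<^sup>+\<omega>. \<psi> \<omega> * indicator A (X t \<omega>) \<partial>M) =
    (\<integral>\<^sup>+\<omega>. \<psi> \<omega> * (\<integral>\<^sup>+b. ennreal (q s t (X s \<omega>) b) * indicator A b \<partial>lborel) \<partial>M)"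
proof -
  let ?F = "natural_filtration M T X s"
  interpret prob_space M by (rule prob_space_M)
  interpret finite_measure_subalgebra M ?F
    by (unfold_locales) (rule subalgebra_X)
  note [measurable] = q_measurable[OF st]
  have [measurable]: "X s \<in> borel_measurable ?F"
    by (rule natural_filtration_measurable) (use st in auto)
  have XM [measurable]: "X s \<in> borel_measurable M" "X t \<in> borel_measurable M" using st by auto
  note A[measurable]
  define I where "I = (indicator (X t -` A \<inter> space M) :: 'w \<Rightarrow> real)"
  define G where "G \<omega> = (LINT b:A|lborel. q s t (X s \<omega>) b)" for \<omega>
  have I_meas [measurable]: "I \<in> borel_measurable M" unfolding I_def by measurable
  have int_I: "integrable M I" unfolding I_def by (simp add: emeasure_eq_measure)
  have G_meas [measurable]: "G \<in> borel_measurable ?F"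
    unfolding G_def set_lebesgue_integral_def by measurable
  have G_measM [measurable]: "G \<in> borel_measurable M"
    by (rule measurable_from_subalg[OF subalg G_meas])
  have AE_G: "AE \<omega> in M. real_cond_exp M ?F I \<omega> = G \<omega>"
    using markov A st unfolding markov_with_densities_def I_def G_def by simp
  have int_G: "integrable M G"
    using real_cond_exp_int(1)[OF int_I] integrable_cong_AE[OF _ G_measM AE_G] by simp
  \<comment> \<open>The finite mass of \<open>q\<close> rules out that the Bochner integral is undefined and thereby \<open>0\<close>.\<close>
  have enn_G: "ennreal (G \<omega>) = (\<integral>\<^sup>+b. ennreal (q s t (X s \<omega>) b) * indicator A b \<partial>lborel)" (is "_ = ?g \<omega>") for \<omega>
  proof -
    have "?g \<omega> \<le> (\<integral>\<^sup>+b. ennreal (q s t (X s \<omega>) b) \<partial>lborel)"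
      by (intro nn_integral_mono) (auto simp: indicator_def)
    also have "\<dots> < \<infinity>" by (rule q_finite[OF st])
    finally have "?g \<omega> < \<infinity>" .
    moreover have "?g \<omega> = (\<integral>\<^sup>+b. ennreal (indicator A b *\<^sub>R q s t (X s \<omega>) b) \<partial>lborel)"
      by (intro nn_integral_cong) (auto simp: indicator_def)
    moreover have "G \<omega> = enn2real (\<integral>\<^sup>+b. ennreal (indicator A b *\<^sub>R q s t (X s \<omega>) b) \<partial>lborel)"
      unfolding G_def set_lebesgue_integral_def
      by (intro integral_eq_nn_integral) (auto simp: q_nonneg[OF st])
    ultimately show ?thesis by simp
  qed
  have G_nonneg: "G \<omega> \<ge> 0" for \<omega>
    unfolding G_def set_lebesgue_integral_def by (simp add: q_nonneg[OF st])
  have eq: "(\<integral>\<^sup>+\<omega>\<in>E. ennreal (I \<omega>) \<partial>M) = (\<integral>\<^sup>+\<omega>\<in>E. ennreal (G \<omega>) \<partial>M)" if E: "E \<in> sets ?F" for E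
  proof -
    have EM [measurable]: "E \<in> sets M" using E subalg unfolding subalgebra_def by auto
    have "(\<integral>\<^sup>+\<omega>\<in>E. ennreal (f \<omega>) \<partial>M) = ennreal (\<integral>\<omega>\<in>E. f \<omega> \<partial>M)"
      if "integrable M f" "\<And>\<omega>. f \<omega> \<ge> 0" for f
    proof -
      have "(\<integral>\<^sup>+\<omega>\<in>E. ennreal (f \<omega>) \<partial>M) = (\<integral>\<^sup>+\<omega>. ennreal (indicator E \<omega> *\<^sub>R f \<omega>) \<partial>M)"
        by (intro nn_integral_cong) (auto simp: indicator_def)
      also have "\<dots> = ennreal (\<integral>\<omega>\<in>E. f \<omega> \<partial>M)"
        unfolding set_lebesgue_integral_def using that
        by (intro nn_integral_eq_integral integrable_mult_indicator) auto
      finally show ?thesis .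
    qed
    moreover have "(\<integral>\<omega>\<in>E. I \<omega> \<partial>M) = (\<integral>\<omega>\<in>E. real_cond_exp M ?F I \<omega> \<partial>M)"
      by (rule real_cond_exp_intA[OF int_I E])
    moreover have "(\<integral>\<omega>\<in>E. real_cond_exp M ?F I \<omega> \<partial>M) = (\<integral>\<omega>\<in>E. G \<omega> \<partial>M)"
      using AE_G by (intro set_lebesgue_integral_cong_AE) auto
    ultimately show ?thesis using int_I int_G G_nonneg by (simp add: I_def)
  qed
  have AE_nn: "AE \<omega> in M. ennreal (G \<omega>) = nn_cond_exp M ?F (\<lambda>\<omega>. ennreal (I \<omega>)) \<omega>"
    using eq by (intro nn_cond_exp_charact) auto
  have "(\<integral>\<^sup>+\<omega>. \<psi> \<omega> * indicator A (X t \<omega>) \<partial>M) = (\<integral>\<^sup>+\<omega>. \<psi> \<omega> * ennreal (I \<omega>) \<partial>M)"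
    by (intro nn_integral_cong) (auto simp: I_def indicator_def)
  also have "\<dots> = (\<integral>\<^sup>+\<omega>. \<psi> \<omega> * nn_cond_exp M ?F (\<lambda>\<omega>. ennreal (I \<omega>)) \<omega> \<partial>M)"
    using \<psi> by (intro nn_cond_exp_intg[symmetric]) auto
  also have "\<dots> = (\<integral>\<^sup>+\<omega>. \<psi> \<omega> * ennreal (G \<omega>) \<partial>M)"
    using AE_nn by (intro nn_integral_cong_AE) (auto elim!: eventually_mono)
  finally show ?thesis by (simp add: enn_G)
qed

text \<open>
  The Markov property for test functions instead of events: given the past, the law of \<open>X t\<close> has the
  density \<open>q s t (X s \<omega>)\<close>. By Tonelli both sides are integrals of \<open>f\<close>, against two measures that agree on
  events by the definition.
\<close>

lemma markov_transition_nn_integral: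
  assumes st: "s \<in> T" "t \<in> T" "s < t"
    and \<psi>: "\<psi> \<in> borel_measurable (natural_filtration M T X s)" and f: "f \<in> borel_measurable borel"
  shows "(\<integral>\<^sup>+\<omega>. \<psi> \<omega> * f (X t \<omega>) \<partial>M) =
    (\<integral>\<^sup>+\<omega>. \<psi> \<omega> * (\<integral>\<^sup>+b. ennreal (q s t (X s \<omega>) b) * f b \<partial>lborel) \<partial>M)"
proof -
  interpret prob_space M by (rule prob_space_M)
  interpret pair_sigma_finite lborel M by unfold_locales
  note [measurable] = q_measurable[OF st] f
  have [measurable]: "X s \<in> borel_measurable M" "X t \<in> borel_measurable M" using st by auto
  have [measurable]: "\<psi> \<in> borel_measurable M"
    by (rule measurable_from_subalg[OF subalgebra_X \<psi>])
  define k where "k b = (\<integral>\<^sup>+\<omega>. \<psi> \<omega> * ennreal (q s t (X s \<omega>) b) \<partial>M)" for b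
  have [measurable]: "k \<in> borel_measurable borel" unfolding k_def by measurable
  have swap: "(\<integral>\<^sup>+\<omega>. \<psi> \<omega> * (\<integral>\<^sup>+b. ennreal (q s t (X s \<omega>) b) * g b \<partial>lborel) \<partial>M) =
      (\<integral>\<^sup>+b. k b * g b \<partial>lborel)" if [measurable]: "g \<in> borel_measurable borel" for g
  proof -
    have "(\<integral>\<^sup>+\<omega>. \<psi> \<omega> * (\<integral>\<^sup>+b. ennreal (q s t (X s \<omega>) b) * g b \<partial>lborel) \<partial>M) =
        (\<integral>\<^sup>+\<omega>. (\<integral>\<^sup>+b. \<psi> \<omega> * ennreal (q s t (X s \<omega>) b) * g b \<partial>lborel) \<partial>M)"
      by (intro nn_integral_cong, subst nn_integral_cmult[symmetric]) (auto simp: mult.assoc)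
    also have "\<dots> = (\<integral>\<^sup>+b. (\<integral>\<^sup>+\<omega>. \<psi> \<omega> * ennreal (q s t (X s \<omega>) b) * g b \<partial>M) \<partial>lborel)"
      by (rule Fubini') measurable
    also have "\<dots> = (\<integral>\<^sup>+b. k b * g b \<partial>lborel)"
      unfolding k_def by (intro nn_integral_cong nn_integral_multc) measurable
    finally show ?thesis .
  qed
  have "distr (density M \<psi>) borel (X t) = density lborel k"
  proof (rule measure_eqI)
    fix A assume "A \<in> sets (distr (density M \<psi>) borel (X t))"
    hence A [measurable]: "A \<in> sets borel" by simp
    have "emeasure (distr (density M \<psi>) borel (X t)) A =
        (\<integral>\<^sup>+\<omega>. \<psi> \<omega> * indicator (X t -` A \<inter> space M) \<omega> \<partial>M)"
      by (subst emeasure_distr) (auto simp: emeasure_density)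
    also have "\<dots> = (\<integral>\<^sup>+\<omega>. \<psi> \<omega> * indicator A (X t \<omega>) \<partial>M)"
      by (intro nn_integral_cong) (auto simp: indicator_def)
    also have "\<dots> = (\<integral>\<^sup>+b. k b * indicator A b \<partial>lborel)"
      unfolding transition_indicator[OF st \<psi> A] by (rule swap) measurable
    finally show "emeasure (distr (density M \<psi>) borel (X t)) A = emeasure (density lborel k) A"
      by (simp add: emeasure_density)
  qed simp
  hence "(\<integral>\<^sup>+b. f b \<partial>distr (density M \<psi>) borel (X t)) = (\<integral>\<^sup>+b. f b \<partial>density lborel k)" by simp
  thus ?thesis
    by (simp add: swap[OF f] nn_integral_distr nn_integral_density)
qed

text \<open>
  The conditional expectation, given the past up to \<open>v\<close>, of a finite product over later times is a
  function \<open>\<phi>\<close> of the present. Induction adds a new earliest time \<open>b\<close>: by the induction hypothesis at \<open>b\<close> the remaining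
  factors become a function of \<open>X b\<close>, and the transition from \<open>v\<close> to \<open>b\<close> finishes the step.
\<close>

lemma markov_future_product:
  assumes "finite J" "J \<subseteq> T" "v \<in> T" "\<And>j. j \<in> J \<Longrightarrow> v \<le> j"
    and "\<And>j. j \<in> J \<Longrightarrow> f j \<in> borel_measurable borel"
  shows "\<exists>\<phi>::real^'n \<Rightarrow> ennreal. \<phi> \<in> borel_measurable borel \<and>
    (\<forall>\<psi>\<in>borel_measurable (natural_filtration M T X v).
      (\<integral>\<^sup>+\<omega>. \<psi> \<omega> * (\<Prod>j\<in>J. f j (X j \<omega>)) \<partial>M) = (\<integral>\<^sup>+\<omega>. \<psi> \<omega> * \<phi> (X v \<omega>) \<partial>M))"
  using assms
proof (induction J arbitrary: v rule: finite_linorder_min_induct)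
  case empty
  show ?case by (rule exI[of _ "\<lambda>_. 1"]) simp
next
  case (insert b J)
  have b: "b \<in> T" "v \<le> b" "b \<notin> J" using insert by auto
  obtain \<phi> :: "real^'n \<Rightarrow> ennreal" where \<phi> [measurable]: "\<phi> \<in> borel_measurable borel"
    and eq: "\<And>\<psi>. \<psi> \<in> borel_measurable (natural_filtration M T X b) \<Longrightarrow>
      (\<integral>\<^sup>+\<omega>. \<psi> \<omega> * (\<Prod>j\<in>J. f j (X j \<omega>)) \<partial>M) = (\<integral>\<^sup>+\<omega>. \<psi> \<omega> * \<phi> (X b \<omega>) \<partial>M)"
    using insert.IH[of b] insert.hyps insert.prems b by (auto simp: less_imp_le)
  have fb [measurable]: "f b \<in> borel_measurable borel" using insert.prems by simp
  define g where "g y = f b y * \<phi> y" for y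
  have g [measurable]: "g \<in> borel_measurable borel" unfolding g_def by measurable
  have *: "(\<integral>\<^sup>+\<omega>. \<psi> \<omega> * (\<Prod>j\<in>insert b J. f j (X j \<omega>)) \<partial>M) = (\<integral>\<^sup>+\<omega>. \<psi> \<omega> * g (X b \<omega>) \<partial>M)"
    if \<psi>: "\<psi> \<in> borel_measurable (natural_filtration M T X v)" for \<psi>
  proof -
    have [measurable]: "\<psi> \<in> borel_measurable (natural_filtration M T X b)"
      by (rule measurable_from_subalg[OF natural_filtration_mono[OF b(2)] \<psi>])
    have [measurable]: "X b \<in> borel_measurable (natural_filtration M T X b)"
      by (rule natural_filtration_measurable) (use b in auto)
    have "(\<lambda>\<omega>. \<psi> \<omega> * f b (X b \<omega>)) \<in> borel_measurable (natural_filtration M T X b)" by measurable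
    from eq[OF this] show ?thesis using insert.hyps b by (simp add: g_def mult.assoc)
  qed
  show ?case
  proof (cases "v = b")
    case True
    thus ?thesis using * g by blast
  next
    case False
    hence "v < b" using b by simp
    have [measurable]: "(\<lambda>(a, b'). q v b a b') \<in> borel_measurable (borel \<Otimes>\<^sub>M borel)"
      using q_measurable insert.prems b \<open>v < b\<close> by simp
    have "(\<lambda>a. \<integral>\<^sup>+y. ennreal (q v b a y) * g y \<partial>lborel) \<in> borel_measurable borel" by measurable
    thus ?thesis
      using * markov_transition_nn_integral[OF insert.prems(2) b(1) \<open>v < b\<close> _ g]
      by (intro exI[of _ "\<lambda>a. \<integral>\<^sup>+y. ennreal (q v b a y) * g y \<partial>lborel"]) simp
  qed
qed

text \<open>
  Given the future from \<open>v\<close> on, the earlier value \<open>X u\<close> has the density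
  \<open>y \<mapsto> m\<^sub>u y * q u v y (X v \<omega>) / m\<^sub>v (X v \<omega>)\<close> of Bayes' rule. For a future event that depends on \<open>X v\<close> alone this
  is Tonelli's theorem. Under an integral against a function of the path up to \<open>v\<close>, a finite-dimensional
  cylinder of the future can be replaced by a function of \<open>X v\<close> (\<open>markov_future_product\<close>), so the identity
  extends to cylinders. Both sides are finite measures in \<open>E\<close>, and a finite measure on a product space
  is determined by its values on cylinders.
\<close>

lemma markov_backward_transition:
  fixes m\<^sub>u m\<^sub>v :: "real^'n \<Rightarrow> real"
  assumes uv: "u \<in> T" "v \<in> T" "u < v"
    and law_u: "distributed M lborel (X u) (\<lambda>y. ennreal (m\<^sub>u y))"
    and law_v: "distributed M lborel (X v) (\<lambda>y. ennreal (m\<^sub>v y))"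
    and m_meas: "m\<^sub>u \<in> borel_measurable borel" "m\<^sub>v \<in> borel_measurable borel"
    and m_pos: "\<And>y. m\<^sub>u y \<ge> 0" "\<And>y. m\<^sub>v y > 0"
    and A: "A \<in> sets borel"
    and E: "E \<in> sigma_sets (space M) (\<Union>w\<in>{w\<in>T. v \<le> w}. {X w -` B \<inter> space M | B. B \<in> sets borel})"
  shows "(\<integral>\<^sup>+\<omega>. indicator A (X u \<omega>) * indicator E \<omega> \<partial>M) =
    (\<integral>\<^sup>+\<omega>. (\<integral>\<^sup>+y. indicator A y * ennreal (m\<^sub>u y * q u v y (X v \<omega>) / m\<^sub>v (X v \<omega>)) \<partial>lborel) * indicator E \<omega> \<partial>M)"
proof -
  interpret prob_space M by (rule prob_space_M)
  interpret lborel_pair: pair_sigma_finite "lborel :: (real^'n) measure" "lborel :: (real^'n) measure" by unfold_locales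
  note [measurable] = q_measurable[OF uv] m_meas A
  have X_uv [measurable]: "X u \<in> borel_measurable M" "X v \<in> borel_measurable M" using uv by auto
  define g where "g z = (\<integral>\<^sup>+y. indicator A y * ennreal (m\<^sub>u y * q u v y z / m\<^sub>v z) \<partial>lborel)" for z
  have g_meas [measurable]: "g \<in> borel_measurable borel" unfolding g_def by measurable
  have at_present: "(\<integral>\<^sup>+\<omega>. indicator A (X u \<omega>) * \<phi> (X v \<omega>) \<partial>M) = (\<integral>\<^sup>+\<omega>. g (X v \<omega>) * \<phi> (X v \<omega>) \<partial>M)"
    if [measurable]: "\<phi> \<in> borel_measurable borel" for \<phi>
  proof -
    have [measurable]: "X u \<in> borel_measurable (natural_filtration M T X u)"
      by (rule natural_filtration_measurable) (use uv in auto)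
    have "(\<integral>\<^sup>+\<omega>. indicator A (X u \<omega>) * \<phi> (X v \<omega>) \<partial>M) =
       (\<integral>\<^sup>+\<omega>. indicator A (X u \<omega>) * (\<integral>\<^sup>+z. ennreal (q u v (X u \<omega>) z) * \<phi> z \<partial>lborel) \<partial>M)"
      by (rule markov_transition_nn_integral[OF uv]) measurable
    also have "\<dots> = (\<integral>\<^sup>+y. ennreal (m\<^sub>u y) * (indicator A y * (\<integral>\<^sup>+z. ennreal (q u v y z) * \<phi> z \<partial>lborel)) \<partial>lborel)"
      by (rule distributed_nn_integral[OF law_u, symmetric]) measurable
    also have "\<dots> = (\<integral>\<^sup>+y. (\<integral>\<^sup>+z. ennreal (m\<^sub>v z) * (indicator A y * ennreal (m\<^sub>u y * q u v y z / m\<^sub>v z)) * \<phi> z \<partial>lborel) \<partial>lborel)"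
    proof (intro nn_integral_cong)
      fix y :: "real^'n"
      have "ennreal (m\<^sub>u y) * ennreal (q u v y z) = ennreal (m\<^sub>v z) * ennreal (m\<^sub>u y * q u v y z / m\<^sub>v z)" for z
        using m_pos(1)[of y] m_pos(2)[of z] q_nonneg[OF uv, of y z]
        by (simp add: ennreal_mult[symmetric])
      hence "ennreal (m\<^sub>v z) * (indicator A y * ennreal (m\<^sub>u y * q u v y z / m\<^sub>v z)) * \<phi> z =
          ennreal (m\<^sub>u y) * indicator A y * (ennreal (q u v y z) * \<phi> z)" for z
        by (metis mult.assoc mult.commute)
      thus "ennreal (m\<^sub>u y) * (indicator A y * (\<integral>\<^sup>+z. ennreal (q u v y z) * \<phi> z \<partial>lborel)) =
          (\<integral>\<^sup>+z. ennreal (m\<^sub>v z) * (indicator A y * ennreal (m\<^sub>u y * q u v y z / m\<^sub>v z)) * \<phi> z \<partial>lborel)"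
        by (simp add: nn_integral_cmult mult.assoc)
    qed
    also have "\<dots> = (\<integral>\<^sup>+z. (\<integral>\<^sup>+y. ennreal (m\<^sub>v z) * (indicator A y * ennreal (m\<^sub>u y * q u v y z / m\<^sub>v z)) * \<phi> z \<partial>lborel) \<partial>lborel)"
      by (rule lborel_pair.Fubini') measurable
    also have "\<dots> = (\<integral>\<^sup>+z. ennreal (m\<^sub>v z) * (g z * \<phi> z) \<partial>lborel)"
      unfolding g_def by (intro nn_integral_cong) (simp add: nn_integral_cmult nn_integral_multc, simp add: mult.assoc)
    also have "\<dots> = (\<integral>\<^sup>+\<omega>. g (X v \<omega>) * \<phi> (X v \<omega>) \<partial>M)"
      by (rule distributed_nn_integral[OF law_v]) measurable
    finally show ?thesis .
  qed
  define I where "I = {w \<in> T. v \<le> w}"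
  define P where "P = (PiM I (\<lambda>_. borel) :: (real \<Rightarrow> real^'n) measure)"
  define Z where "Z \<omega> = (\<lambda>w\<in>I. X w \<omega>)" for \<omega>
  have Z [measurable]: "Z \<in> measurable M P"
    unfolding Z_def P_def by (intro measurable_restrict) (auto simp: I_def)
  define N1 where "N1 = distr (density M (\<lambda>\<omega>. indicator A (X u \<omega>))) P Z"
  define N2 where "N2 = distr (density M (\<lambda>\<omega>. g (X v \<omega>))) P Z"
  have N: "emeasure (distr (density M h) P Z) C = (\<integral>\<^sup>+\<omega>. h \<omega> * indicator C (Z \<omega>) \<partial>M)"
    if [measurable]: "h \<in> borel_measurable M" "C \<in> sets P" for h C
  proof -
    have "emeasure (distr (density M h) P Z) C = (\<integral>\<^sup>+\<omega>. h \<omega> * indicator (Z -` C \<inter> space M) \<omega> \<partial>M)"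
      by (subst emeasure_distr) (auto simp: emeasure_density)
    also have "\<dots> = (\<integral>\<^sup>+\<omega>. h \<omega> * indicator C (Z \<omega>) \<partial>M)"
      by (intro nn_integral_cong) (auto simp: indicator_def)
    finally show ?thesis .
  qed
  have "N1 = N2"
  proof (rule measure_eqI_PiM_infinite[of _ I "\<lambda>_. borel"])
    show "sets N1 = sets (PiM I (\<lambda>_. borel))" "sets N2 = sets (PiM I (\<lambda>_. borel))"
      by (simp_all add: N1_def N2_def P_def)
    have "emeasure N1 (space N1) \<le> 1"
    proof -
      have "emeasure N1 (space N1) = (\<integral>\<^sup>+\<omega>. indicator A (X u \<omega>) * indicator (space P) (Z \<omega>) \<partial>M)"
        unfolding N1_def by (subst N[symmetric]) auto
      also have "\<dots> \<le> (\<integral>\<^sup>+\<omega>. 1 \<partial>M)" by (intro nn_integral_mono) (auto simp: indicator_def)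
      finally show ?thesis by (simp add: emeasure_space_1)
    qed
    thus "finite_measure N1" by (intro finite_measureI) (auto simp: top_unique)
  next
    fix B J assume J: "finite J" "J \<subseteq> I" and B: "\<And>j. j \<in> J \<Longrightarrow> B j \<in> sets (borel :: (real^'n) measure)"
    let ?C = "prod_emb I (\<lambda>_. borel) J (Pi\<^sub>E J B)"
    have C: "?C \<in> sets P" unfolding P_def using J B by (intro sets_PiM_I) auto
    have ind: "indicator ?C (Z \<omega>) = (\<Prod>j\<in>J. indicator (B j) (X j \<omega>) :: ennreal)" for \<omega>
    proof -
      have "Z \<omega> \<in> ?C \<longleftrightarrow> (\<forall>j\<in>J. X j \<omega> \<in> B j)"
        using J by (auto simp: prod_emb_def Z_def PiE_def Pi_def)
      moreover have "(\<Prod>j\<in>J. indicator (B j) (X j \<omega>) :: ennreal) = (if \<forall>j\<in>J. X j \<omega> \<in> B j then 1 else 0)"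
        using J(1) by (auto simp: indicator_def intro!: prod.neutral prod_zero)
      ultimately show ?thesis by (simp add: indicator_def)
    qed
    have "J \<subseteq> T" "\<And>j. j \<in> J \<Longrightarrow> v \<le> j" using J by (auto simp: I_def)
    then obtain \<phi> :: "real^'n \<Rightarrow> ennreal" where \<phi>: "\<phi> \<in> borel_measurable borel"
      and eq: "\<And>\<psi>. \<psi> \<in> borel_measurable (natural_filtration M T X v) \<Longrightarrow>
        (\<integral>\<^sup>+\<omega>. \<psi> \<omega> * (\<Prod>j\<in>J. indicator (B j) (X j \<omega>)) \<partial>M) = (\<integral>\<^sup>+\<omega>. \<psi> \<omega> * \<phi> (X v \<omega>) \<partial>M)"
      using markov_future_product[of J v "\<lambda>j. indicator (B j)"] J(1) B uv(2) by auto
    have [measurable]: "X u \<in> borel_measurable (natural_filtration M T X v)"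
      "X v \<in> borel_measurable (natural_filtration M T X v)"
      using uv by (auto intro!: natural_filtration_measurable)
    have "emeasure N1 ?C = (\<integral>\<^sup>+\<omega>. indicator A (X u \<omega>) * \<phi> (X v \<omega>) \<partial>M)"
      unfolding N1_def by (subst N[OF _ C], measurable, unfold ind, rule eq) measurable
    also have "\<dots> = (\<integral>\<^sup>+\<omega>. g (X v \<omega>) * \<phi> (X v \<omega>) \<partial>M)" by (rule at_present[OF \<phi>])
    also have "\<dots> = emeasure N2 ?C"
      unfolding N2_def by (subst N[OF _ C], measurable, unfold ind, rule eq[symmetric]) measurable
    finally show "emeasure N1 ?C = emeasure N2 ?C" .
  qed
  have "E \<in> sets (vimage_algebra (space M) Z P)"
  proof -
    have "(\<Union>w\<in>{w\<in>T. v \<le> w}. {X w -` B \<inter> space M | B. B \<in> sets borel})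
        \<subseteq> sets (vimage_algebra (space M) Z P)"
    proof safe
      fix w B assume w: "w \<in> T" "v \<le> w" and B: "B \<in> sets (borel :: (real^'n) measure)"
      hence wI: "w \<in> I" by (simp add: I_def)
      have "X w -` B \<inter> space M = Z -` ((\<lambda>\<omega>. \<omega> w) -` B \<inter> space P) \<inter> space M"
        using wI measurable_space[OF Z] by (auto simp: Z_def)
      moreover have "(\<lambda>\<omega>. \<omega> w) -` B \<inter> space P \<in> sets P"
        unfolding P_def using wI B by (intro measurable_sets[OF measurable_component_singleton]) auto
      ultimately show "X w -` B \<inter> space M \<in> sets (vimage_algebra (space M) Z P)"
        by (metis in_vimage_algebra)
    qed
    from sets.sigma_sets_subset[OF this] E show ?thesis by auto
  qed
  then obtain C where C [measurable]: "C \<in> sets P" and EC: "E = Z -` C \<inter> space M"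
    using measurable_space[OF Z] by (subst (asm) sets_vimage_algebra2) auto
  have ind: "indicator C (Z \<omega>) = (indicator E \<omega> :: ennreal)" if "\<omega> \<in> space M" for \<omega>
    using that by (simp add: EC indicator_def)
  have "(\<integral>\<^sup>+\<omega>. indicator A (X u \<omega>) * indicator E \<omega> \<partial>M) = emeasure N1 C"
    unfolding N1_def by (subst N) (auto intro!: nn_integral_cong simp: ind)
  also have "\<dots> = (\<integral>\<^sup>+\<omega>. g (X v \<omega>) * indicator E \<omega> \<partial>M)"
    unfolding \<open>N1 = N2\<close> N2_def by (subst N) (auto intro!: nn_integral_cong simp: ind)
  finally show ?thesis unfolding g_def .
qed

end

section \<open>The inverted process\<close>

lemma nn_integral_lborel_scaleR:
  fixes f :: "'a::euclidean_space \<Rightarrow> ennreal"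
  assumes "c > 0" and [measurable]: "f \<in> borel_measurable borel"
  shows "(\<integral>\<^sup>+x. f x \<partial>lborel) = ennreal (c ^ DIM('a)) * (\<integral>\<^sup>+x. f (c *\<^sub>R x) \<partial>lborel)"
proof -
  have "(\<integral>\<^sup>+x. f x \<partial>lborel) =
      (\<integral>\<^sup>+x. f x \<partial>density (distr lborel borel (\<lambda>x. 0 + c *\<^sub>R x)) (\<lambda>_. ennreal (\<bar>c\<bar> ^ DIM('a))))"
    using lborel_affine[of c "0 :: 'a"] assms(1) by simp
  also have "\<dots> = ennreal (c ^ DIM('a)) * (\<integral>\<^sup>+x. f (c *\<^sub>R x) \<partial>lborel)"
    using assms(1) by (simp add: nn_integral_density nn_integral_distr nn_integral_cmult)
  finally show ?thesis .
qed

lemma distributed_of_markov_start: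
  assumes "markov_with_densities M {0..} X (\<lambda>s t. p (t - s))" "semigroup_densities p"
    and start: "AE \<omega> in M. X 0 \<omega> = x" and u: "u > 0"
  shows "distributed M lborel (X u) (\<lambda>y. ennreal (p u x y))"
proof -
  interpret prob_space M using assms(1) unfolding markov_with_densities_def by simp
  have Xu: "X u \<in> borel_measurable M"
    using assms(1) u unfolding markov_with_densities_def by simp
  have pu [measurable]: "(\<lambda>y. p u x y) \<in> borel_measurable borel"
    by (rule semigroup_densities_measurable_compose[OF assms(2) u]) auto
  have "emeasure (distr M lborel (X u)) A = emeasure (density lborel (\<lambda>y. ennreal (p u x y))) A"
    if "A \<in> sets lborel" for A
  proof -
    have A [measurable]: "A \<in> sets borel" using that by simp
    have "emeasure (distr M lborel (X u)) A = (\<integral>\<^sup>+\<omega>. 1 * indicator A (X u \<omega>) \<partial>M)"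
      using Xu by (subst emeasure_distr) (auto simp: indicator_def simp flip: nn_integral_indicator intro!: nn_integral_cong)
    also have "\<dots> = (\<integral>\<^sup>+\<omega>. 1 * (\<integral>\<^sup>+b. ennreal (p (u - 0) (X 0 \<omega>) b) * indicator A b \<partial>lborel) \<partial>M)"
    proof (rule markov_transition_nn_integral[OF assms(1)])
      fix s t :: real and a b assume "s < t"
      thus "0 \<le> p (t - s) a b"
        using semigroup_densities_pos[OF assms(2), of "t - s" a b] by simp
      show "(\<integral>\<^sup>+b. ennreal (p (t - s) a b) \<partial>lborel) < \<infinity>"
        using semigroup_densities_nn_integral_1[OF assms(2), of "t - s" a] \<open>s < t\<close> by simp
    qed (use u in auto)
    also have "\<dots> = (\<integral>\<^sup>+\<omega>. (\<integral>\<^sup>+b. ennreal (p u x b) * indicator A b \<partial>lborel) \<partial>M)"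
      using start by (intro nn_integral_cong_AE) (auto elim!: eventually_mono)
    also have "\<dots> = emeasure (density lborel (\<lambda>y. ennreal (p u x y))) A"
      by (simp add: emeasure_space_1 emeasure_density)
    finally show ?thesis .
  qed
  thus ?thesis unfolding distributed_def using Xu pu
    by (auto intro!: measure_eqI)
qed

text \<open>
  The past of the inverted process up to \<open>s\<close> is generated by \<open>X\<close> at the times \<open>\<ge> 1 / s\<close>, so its
  transitions are the backward transitions of \<open>X\<close> from \<open>v = 1 / s\<close> to \<open>u = 1 / t\<close>. Under the law started at \<open>x\<close>
  the densities of \<open>X u\<close> and \<open>X v\<close> are \<open>p u x\<close> and \<open>p v x\<close>. The substitution \<open>b = t powr \<alpha> *\<^sub>R y\<close>
  accounts for the factor \<open>t powr (- (n * \<alpha>))\<close> in \<^const>\<open>inversion_density\<close>.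
\<close>

lemma markov_time_inversion:
  fixes p :: "real \<Rightarrow> real^'n \<Rightarrow> real^'n \<Rightarrow> real"
  assumes markov: "markov_with_densities M {0..} X (\<lambda>s t. p (t - s))"
    and p: "semigroup_densities p" and start: "AE \<omega> in M. X 0 \<omega> = x"
  shows "markov_with_densities M {0<..} (time_inversion \<alpha> X) (inversion_density \<alpha> p x)"
proof -
  let ?Y = "time_inversion \<alpha> X"
  interpret prob_space M using markov unfolding markov_with_densities_def by simp
  have X_meas: "X t \<in> borel_measurable M" if "t \<ge> 0" for t
    using markov that unfolding markov_with_densities_def by simp
  have Y_meas: "?Y t \<in> borel_measurable M" if "t > 0" for t
    unfolding time_inversion_def using X_meas[of "1 / t"] that by simp
  note pos = semigroup_densities_pos[OF p]
  have q_meas: "(\<lambda>(a, b). inversion_density \<alpha> p x s t a b) \<in> borel_measurable (borel \<Otimes>\<^sub>M borel)"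
    if "0 < s" "s < t" for s t
  proof -
    have "1 / s - 1 / t > 0" "1 / s > 0" "1 / t > 0" using that by (auto simp: frac_less2)
    thus ?thesis unfolding inversion_density_def case_prod_beta
      by (intro borel_measurable_times borel_measurable_divide borel_measurable_const
          semigroup_densities_measurable_compose[OF p]) measurable
  qed
  have "AE \<omega> in M. real_cond_exp M (natural_filtration M {0<..} ?Y s)
      (indicator (?Y t -` A \<inter> space M)) \<omega> = (LINT b:A|lborel. inversion_density \<alpha> p x s t (?Y s \<omega>) b)"
    if st: "0 < s" "s < t" and A: "A \<in> sets borel" for s t A
  proof -
    let ?F = "natural_filtration M {0<..} ?Y s"
    interpret finite_measure_subalgebra M ?F
      by unfold_locales (rule subalgebra_natural_filtration, simp add: Y_meas)
    define u v where "u = 1 / t" and "v = 1 / s"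
    have uv: "0 < u" "u < v" "0 < v" using st by (auto simp: u_def v_def frac_less2)
    have vu: "v - u > 0" using uv by simp
    define A' where "A' = (\<lambda>y. t powr \<alpha> *\<^sub>R y) -` A"
    note [measurable] = A q_meas[OF st] Y_meas[OF st(1)] Y_meas[of t]
    have A' [measurable]: "A' \<in> sets borel"
      using measurable_sets_borel[of "\<lambda>y::real^'n. t powr \<alpha> *\<^sub>R y" borel A] A by (simp add: A'_def)
    have [measurable]: "?Y s \<in> borel_measurable ?F"
      by (rule natural_filtration_measurable) (use st in auto)
    define g where "g z = (\<integral>\<^sup>+y. indicator A' y * ennreal (p u x y * p (v - u) y z / p v x z) \<partial>lborel)" for z
    define G where "G \<omega> = (LINT b:A|lborel. inversion_density \<alpha> p x s t (?Y s \<omega>) b)" for \<omega>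
    \<comment> \<open>By Chapman-Kolmogorov the Bayes density has mass one, so the Bochner integral \<open>G\<close> is defined.\<close>
    have g_le: "g z \<le> 1" for z
    proof -
      have [measurable]: "(\<lambda>y. p u x y) \<in> borel_measurable borel" "(\<lambda>y. p (v - u) y z) \<in> borel_measurable borel"
        using uv by (auto intro!: semigroup_densities_measurable_compose[OF p])
      have "g z \<le> (\<integral>\<^sup>+y. ennreal (inverse (p v x z)) * (ennreal (p u x y) * ennreal (p (v - u) y z)) \<partial>lborel)"
        unfolding g_def using pos[OF uv(1)] pos[OF vu] pos[OF uv(3)]
        by (intro nn_integral_mono)
           (auto simp: indicator_def ennreal_mult[symmetric] less_imp_le divide_inverse mult_ac)
      also have "\<dots> = ennreal (inverse (p v x z)) * ennreal (p (u + (v - u)) x z)"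
        by (subst nn_integral_cmult) (auto simp: semigroup_densities_nn_Chapman_Kolmogorov[OF p uv(1) vu])
      also have "\<dots> = 1"
        using pos[OF uv(3), of x z] by (simp add: ennreal_mult[symmetric] less_imp_le)
      finally show ?thesis .
    qed
    have q_nonneg: "inversion_density \<alpha> p x s t a b \<ge> 0" for a b
      unfolding inversion_density_def using pos uv u_def v_def by (simp add: less_imp_le)
    have enn_G: "ennreal (G \<omega>) = g (X v \<omega>)" for \<omega>
    proof -
      have Ys: "?Y s \<omega> /\<^sub>R s powr \<alpha> = X v \<omega>"
        using st by (simp add: time_inversion_def v_def)
      have q: "inversion_density \<alpha> p x s t (?Y s \<omega>) (t powr \<alpha> *\<^sub>R y) =
          t powr (- (real CARD('n) * \<alpha>)) * (p u x y * p (v - u) y (X v \<omega>) / p v x (X v \<omega>))" for y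
        unfolding inversion_density_def Ys using st by (simp add: u_def v_def)
      have [measurable]: "(\<lambda>b. inversion_density \<alpha> p x s t (?Y s \<omega>) b) \<in> borel_measurable borel"
        using measurable_compose[OF measurable_Pair1' q_meas[OF st], of "?Y s \<omega>"] by simp
      have pw: "(t powr \<alpha>) ^ CARD('n) * t powr (- (real CARD('n) * \<alpha>)) = 1"
        using st by (simp add: powr_realpow[symmetric] powr_powr powr_add[symmetric] mult.commute)
      define Q where "Q b = ennreal (indicator A b *\<^sub>R inversion_density \<alpha> p x s t (?Y s \<omega>) b)" for b
      have Q: "Q \<in> borel_measurable borel" unfolding Q_def by measurable
      have QS: "(\<lambda>y. Q (t powr \<alpha> *\<^sub>R y)) \<in> borel_measurable lborel"
        by (rule measurable_compose[OF _ Q]) simp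
      have "(\<integral>\<^sup>+b. Q b \<partial>lborel) = ennreal ((t powr \<alpha>) ^ CARD('n)) * (\<integral>\<^sup>+y. Q (t powr \<alpha> *\<^sub>R y) \<partial>lborel)"
        using st nn_integral_lborel_scaleR[of "t powr \<alpha>" Q] Q by simp
      also have "\<dots> = (\<integral>\<^sup>+y. ennreal ((t powr \<alpha>) ^ CARD('n)) * Q (t powr \<alpha> *\<^sub>R y) \<partial>lborel)"
        by (rule nn_integral_cmult[OF QS, symmetric])
      also have "\<dots> = g (X v \<omega>)"
        unfolding g_def
      proof (intro nn_integral_cong)
        fix y :: "real^'n"
        define r where "r = p u x y * p (v - u) y (X v \<omega>) / p v x (X v \<omega>)"
        have r: "r \<ge> 0" using pos[OF uv(1)] pos[OF vu] pos[OF uv(3)] by (simp add: r_def less_imp_le)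
        have "ennreal ((t powr \<alpha>) ^ CARD('n)) * ennreal (t powr (- (real CARD('n) * \<alpha>)) * r) = ennreal r"
          using r by (subst ennreal_mult[symmetric]) (auto simp: mult.assoc[symmetric] pw)
        thus "ennreal ((t powr \<alpha>) ^ CARD('n)) * Q (t powr \<alpha> *\<^sub>R y) =
            indicator A' y * ennreal (p u x y * p (v - u) y (X v \<omega>) / p v x (X v \<omega>))"
          unfolding Q_def q r_def[symmetric] by (simp add: A'_def indicator_def)
      qed
      finally have eq: "(\<integral>\<^sup>+b. Q b \<partial>lborel) = g (X v \<omega>)" .
      have "G \<omega> = enn2real (\<integral>\<^sup>+b. Q b \<partial>lborel)"
        unfolding G_def set_lebesgue_integral_def Q_def
        by (intro integral_eq_nn_integral) (auto simp: q_nonneg)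
      moreover have "g (X v \<omega>) < top" using g_le[of "X v \<omega>"] by (metis ennreal_one_less_top order_le_less_trans)
      ultimately show ?thesis unfolding eq by simp
    qed
    have G_nonneg: "G \<omega> \<ge> 0" for \<omega>
      unfolding G_def set_lebesgue_integral_def by (simp add: q_nonneg)
    have G_le: "G \<omega> \<le> 1" for \<omega>
      using g_le[of "X v \<omega>"] unfolding enn_G[symmetric] by simp
    have G_meas [measurable]: "G \<in> borel_measurable ?F"
      unfolding G_def set_lebesgue_integral_def by measurable
    have G_measM [measurable]: "G \<in> borel_measurable M"
      by (rule measurable_from_subalg[OF subalg G_meas])
    have int_G: "integrable M G"
      by (rule integrable_const_bound[of _ 1]) (auto simp: G_nonneg G_le)
    have Yt_set [measurable]: "?Y t -` A \<inter> space M \<in> sets M"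
      using measurable_sets[OF Y_meas[of t] A] st by simp
    have Yt: "\<omega> \<in> ?Y t -` A \<inter> space M \<longleftrightarrow> X u \<omega> \<in> A'" if "\<omega> \<in> space M" for \<omega>
      using that by (simp add: time_inversion_def A'_def u_def)
    have "AE \<omega> in M. real_cond_exp M ?F (indicator (?Y t -` A \<inter> space M)) \<omega> = G \<omega>"
    proof (rule real_cond_exp_charact)
      fix E assume EF: "E \<in> sets ?F"
      have EM [measurable]: "E \<in> sets M" using EF subalg unfolding subalgebra_def by auto
      have E: "E \<in> sigma_sets (space M) (\<Union>w\<in>{w\<in>{0..}. v \<le> w}. {X w -` B \<inter> space M | B. B \<in> sets borel})"
        (is "_ \<in> sigma_sets _ ?S")
      proof -
        have "(\<Union>r\<in>{r\<in>{0<..}. r \<le> s}. {?Y r -` B \<inter> space M | B. B \<in> sets borel}) \<subseteq> ?S"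
        proof safe
          fix r :: real and B :: "(real^'n) set" assume r: "0 < r" "r \<le> s" and B: "B \<in> sets borel"
          have "?Y r -` B \<inter> space M = X (1 / r) -` ((\<lambda>y. r powr \<alpha> *\<^sub>R y) -` B) \<inter> space M"
            by (auto simp: time_inversion_def)
          moreover have "(\<lambda>y. r powr \<alpha> *\<^sub>R y) -` B \<in> sets borel"
            using measurable_sets_borel[of "\<lambda>y::real^'n. r powr \<alpha> *\<^sub>R y" borel B] B by simp
          moreover have "1 / r \<in> {w\<in>{0..}. v \<le> w}" using r by (simp add: v_def frac_le)
          ultimately show "?Y r -` B \<inter> space M \<in> ?S" by blast
        qed
        from sigma_sets_subseteq[OF this] show ?thesis
          using EF unfolding sets_natural_filtration by blast
      qed
      have nn: "(\<integral>\<omega>\<in>E. f \<omega> \<partial>M) = enn2real (\<integral>\<^sup>+\<omega>. ennreal (f \<omega>) * indicator E \<omega> \<partial>M)"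
        if [measurable]: "f \<in> borel_measurable M" and "\<And>\<omega>. f \<omega> \<ge> 0" for f
        unfolding set_lebesgue_integral_def using that(2)
        by (subst integral_eq_nn_integral)
           (auto intro!: arg_cong[of _ _ enn2real] nn_integral_cong simp: indicator_def)
      have "(\<integral>\<^sup>+\<omega>. ennreal (indicator (?Y t -` A \<inter> space M) \<omega>) * indicator E \<omega> \<partial>M) =
          (\<integral>\<^sup>+\<omega>. indicator A' (X u \<omega>) * indicator E \<omega> \<partial>M)"
        using Yt by (intro nn_integral_cong) (auto simp: indicator_def)
      also have "\<dots> = (\<integral>\<^sup>+\<omega>. g (X v \<omega>) * indicator E \<omega> \<partial>M)"
        unfolding g_def
      proof (rule markov_backward_transition[OF markov, of u v "p u x" "p v x" A' E])
        fix s t :: real and a b assume "s < t"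
        thus "0 \<le> p (t - s) a b" using pos[of "t - s" a b] by simp
        show "(\<integral>\<^sup>+b. ennreal (p (t - s) a b) \<partial>lborel) < \<infinity>"
          using semigroup_densities_nn_integral_1[OF p, of "t - s" a] \<open>s < t\<close> by simp
      next
        show "distributed M lborel (X u) (\<lambda>y. ennreal (p u x y))"
          "distributed M lborel (X v) (\<lambda>y. ennreal (p v x y))"
          using uv by (auto intro!: distributed_of_markov_start[OF markov p start])
        show "p u x \<in> borel_measurable borel" "p v x \<in> borel_measurable borel"
          using semigroup_densities_measurable_compose[OF p uv(1), of "\<lambda>_. x" _ "\<lambda>y. y"]
            semigroup_densities_measurable_compose[OF p uv(3), of "\<lambda>_. x" _ "\<lambda>y. y"] by auto
        show "0 \<le> p u x y" "0 < p v x y" for y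
          using pos[OF uv(1), of x y] pos[OF uv(3), of x y] by auto
      qed (use uv A' E in auto)
      also have "\<dots> = (\<integral>\<^sup>+\<omega>. ennreal (G \<omega>) * indicator E \<omega> \<partial>M)" by (simp add: enn_G)
      finally show "(\<integral>\<omega>\<in>E. indicator (?Y t -` A \<inter> space M) \<omega> \<partial>M) = (\<integral>\<omega>\<in>E. G \<omega> \<partial>M)"
        by (simp add: nn G_nonneg)
    qed (auto simp: int_G emeasure_eq_measure)
    thus ?thesis by (simp add: G_def)
  qed
  thus ?thesis
    unfolding markov_with_densities_def using prob_space_axioms Y_meas q_meas by auto
qed

section \<open>Characterization of homogeneity\<close>

text \<open>
  The decomposition of the logarithm gives \<open>p t x y = exp (\<nu> * t) * (exp (g x) / exp (g y)) * p' t x y\<close>,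
  where \<open>p'\<close> has the required form with \<open>\<rho> = c\<close>. A constant \<open>\<theta>\<close> suffices: as the densities are positive
  at the origin, a degree other than \<open>0\<close> is impossible.
\<close>

lemma inversion_form_of_homogeneous_density:
  fixes p :: "real \<Rightarrow> real^'n \<Rightarrow> real^'n \<Rightarrow> real"
  assumes "\<alpha> > 0" and p: "semigroup_densities p"
    and hom: "\<And>x. \<exists>r. \<forall>s t a b. 0 < s \<longrightarrow> s < t \<longrightarrow> inversion_density \<alpha> p x s t a b = r (t - s) a b"
  shows "\<exists>p' \<Phi> \<theta> \<rho>. semigroup_densities p' \<and> has_inversion_form \<alpha> \<Phi> \<theta> \<rho> p' \<and> h_transform_related p' p"
proof -
  note pos = semigroup_densities_pos[OF p]
  define N where "N = real CARD('n) * \<alpha>"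
  have N: "N > 0" using \<open>\<alpha> > 0\<close> by (simp add: N_def)
  define E where "E x t b = ln (p (1 / t) x (b /\<^sub>R t powr \<alpha>))" for x t b
  have "\<forall>x. \<exists>r. \<forall>s t a b. 0 < s \<longrightarrow> s < t \<longrightarrow> inversion_density \<alpha> p x s t a b = r (t - s) a b"
    using hom by simp
  then obtain r where r: "\<forall>x s t a b. 0 < s \<longrightarrow> s < t \<longrightarrow> inversion_density \<alpha> p x s t a b = r x (t - s) a b"
    by (rule choice[THEN exE])
  have E: "homogeneous_log_density \<alpha> N E (\<lambda>x u a b. ln (r x u a b))"
  proof
    show "\<alpha> > 0" by fact
  next
    fix t :: real and x b :: "real^'n" assume t: "t > 0"
    have "(\<lambda>t. (1 / t, x, b /\<^sub>R t powr \<alpha>)) differentiable (at t)"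
    proof -
      have "((\<lambda>t. inverse (t powr \<alpha>)) has_real_derivative - \<alpha> * t powr (- \<alpha> - 1)) (at t)"
        using has_real_derivative_powr[OF t, of "- \<alpha>"] by (simp add: powr_minus)
      hence 1: "((\<lambda>t. inverse (t powr \<alpha>) *\<^sub>R b) has_derivative (\<lambda>h. (- \<alpha> * t powr (- \<alpha> - 1) * h) *\<^sub>R b)) (at t)"
        unfolding has_field_derivative_def by (rule has_derivative_scaleR_left)
      have "((\<lambda>t. 1 / t) has_real_derivative - (1 / (t * t))) (at t)"
        using t by (auto intro!: derivative_eq_intros)
      hence 2: "((\<lambda>t. 1 / t) has_derivative (*) (- (1 / (t * t)))) (at t)"
        by (rule has_field_derivative_imp_has_derivative)
      show ?thesis
        by (rule differentiableI[OF has_derivative_Pair[OF 2 has_derivative_Pair[OF has_derivative_const 1]]])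
    qed
    moreover have "(\<lambda>(t, x, y). p t x y) differentiable (at (1 / t, x, b /\<^sub>R t powr \<alpha>))"
      using t by (intro semigroup_densities_differentiable[OF p]) simp
    ultimately have "((\<lambda>(t, x, y). p t x y) \<circ> (\<lambda>t. (1 / t, x, b /\<^sub>R t powr \<alpha>))) differentiable (at t)"
      by (rule differentiable_chain_at)
    hence d: "(\<lambda>t. p (1 / t) x (b /\<^sub>R t powr \<alpha>)) differentiable (at t)" by (simp add: o_def)
    have "p (1 / t) x (b /\<^sub>R t powr \<alpha>) > 0" using t by (intro pos) simp
    hence "ln differentiable (at (p (1 / t) x (b /\<^sub>R t powr \<alpha>)))"
      using DERIV_ln real_differentiable_def by blast
    with d have "(ln \<circ> (\<lambda>t. p (1 / t) x (b /\<^sub>R t powr \<alpha>))) differentiable (at t)"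
      by (rule differentiable_chain_at)
    thus "(\<lambda>t. E x t b) differentiable (at t)" by (simp add: E_def o_def)
  next
    fix s t :: real and x b a :: "real^'n" assume st: "0 < s" "s < t"
    have t: "t > 0" "1 / s - 1 / t > 0" using st by (auto simp: frac_less2)
    have \<tau>: "1 / (s * t / (t - s)) = 1 / s - 1 / t" using st by (simp add: field_simps)
    have sc: "t powr \<alpha> *\<^sub>R a /\<^sub>R (t - s) powr \<alpha> /\<^sub>R (s * t / (t - s)) powr \<alpha> = a /\<^sub>R s powr \<alpha>"
    proof -
      have "t powr \<alpha> * inverse ((t - s) powr \<alpha>) * inverse ((s * t / (t - s)) powr \<alpha>) = inverse (s powr \<alpha>)"
        using st by (simp add: powr_divide powr_mult divide_simps)
      thus ?thesis by (simp add: mult_ac)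
    qed
    have E\<tau>: "E (b /\<^sub>R t powr \<alpha>) (s * t / (t - s)) (t powr \<alpha> *\<^sub>R a /\<^sub>R (t - s) powr \<alpha>) =
        ln (p (1 / s - 1 / t) (b /\<^sub>R t powr \<alpha>) (a /\<^sub>R s powr \<alpha>))"
      unfolding E_def \<tau> sc by (rule refl)
    have p3: "p (1 / t) x (b /\<^sub>R t powr \<alpha>) > 0" "p (1 / s) x (a /\<^sub>R s powr \<alpha>) > 0"
      "p (1 / s - 1 / t) (b /\<^sub>R t powr \<alpha>) (a /\<^sub>R s powr \<alpha>) > 0"
      using st t by (auto intro!: pos)
    have "ln (r x (t - s) a b) = ln (inversion_density \<alpha> p x s t a b)"
      using r st by simp
    also have "\<dots> = - N * ln t + E x t b - E x s a +
        ln (p (1 / s - 1 / t) (b /\<^sub>R t powr \<alpha>) (a /\<^sub>R s powr \<alpha>))"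
      unfolding inversion_density_def E_def N_def[symmetric] using p3 t
      by (simp add: ln_div ln_mult ln_powr)
    finally show "- N * ln t + E x t b - E x s a +
        E (b /\<^sub>R t powr \<alpha>) (s * t / (t - s)) (t powr \<alpha> *\<^sub>R a /\<^sub>R (t - s) powr \<alpha>) = ln (r x (t - s) a b)"
      unfolding E\<tau> by simp
  qed
  obtain \<nu> C c g \<psi> where
    dec: "\<And>t x y. t > 0 \<Longrightarrow> E x (1 / t) (y /\<^sub>R t powr \<alpha>) =
       \<nu> * t + C - N / 2 * ln t + (c x + c y) / t + g x - g y + \<psi> x (y /\<^sub>R t powr \<alpha>)"
    and c: "\<And>r x. r > 0 \<Longrightarrow> c (r *\<^sub>R x) = r powr (2 / \<alpha>) * c x"
    and \<psi>: "\<And>r x y. r > 0 \<Longrightarrow> \<psi> (r *\<^sub>R x) y = \<psi> x (r *\<^sub>R y)"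
    and \<psi>0: "\<And>x. \<psi> x 0 = 0"
    by (rule homogeneous_log_density.log_density_decomposition[OF E]) (rule that)
  have c0: "c 0 = 0"
  proof -
    have "2 powr 0 < (2::real) powr (2 / \<alpha>)" using \<open>\<alpha> > 0\<close> by (intro powr_less_mono) auto
    moreover have "(2 powr (2 / \<alpha>) - 1) * c 0 = c (2 *\<^sub>R 0) - c 0"
      unfolding c[OF zero_less_numeral] by (simp only: left_diff_distrib mult_1)
    ultimately show ?thesis using \<open>\<alpha> > 0\<close> by simp
  qed
  define p' where "p' t x y =
      exp C * t powr (- (N / 2)) * exp ((c x + c y) / t) * exp (\<psi> x (y /\<^sub>R t powr \<alpha>))" for t x y
  have rel: "p t x y = exp (\<nu> * t) * (exp (g x) / exp (g y)) * p' t x y" if t: "t > 0" for t x y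
  proof -
    have "y /\<^sub>R t powr \<alpha> /\<^sub>R (1 / t) powr \<alpha> = y" using t by (simp add: powr_divide)
    hence "E x (1 / t) (y /\<^sub>R t powr \<alpha>) = ln (p t x y)" by (simp add: E_def)
    hence "p t x y = exp (E x (1 / t) (y /\<^sub>R t powr \<alpha>))" using pos[OF t, of x y] by simp
    also have "\<dots> = exp (\<nu> * t) * (exp (g x) / exp (g y)) *
        (exp C * exp (- (N / 2) * ln t) * exp ((c x + c y) / t) * exp (\<psi> x (y /\<^sub>R t powr \<alpha>)))"
      unfolding dec[OF t] by (simp only: exp_diff[symmetric] exp_add[symmetric]) (simp add: algebra_simps)
    also have "exp (- (N / 2) * ln t) = t powr (- (N / 2))" using t by (simp add: powr_def)
    finally show ?thesis unfolding p'_def .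
  qed
  have "semigroup_densities p'"
  proof (rule semigroup_densities_of_h_transform[OF p, where G = "\<lambda>x. exp (g x)" and C = "exp C"
        and \<kappa> = "N / 2" and \<nu> = \<nu> and c = c])
    show "p' t x 0 = exp C * t powr (- (N / 2)) * exp (c x / t)" for t x
      by (simp add: p'_def c0 \<psi>0)
  qed (use N rel in simp_all)
  moreover have "has_inversion_form \<alpha> (\<lambda>x y. exp C * exp (\<psi> x y)) (\<lambda>_. 1) c p'"
    unfolding has_inversion_form_def scaling_properties_def
  proof (intro conjI allI impI)
    show "\<exists>\<beta>. \<forall>c>0. \<forall>y::real^'n. (1::real) = c powr \<beta> * 1" by (rule exI[of _ 0]) simp
  next
    fix t :: real and x y assume t: "t > 0"
    have "c (z /\<^sub>R t powr (\<alpha> / 2)) = c z / t" for z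
      by (rule homogeneous_divideR_powr_half[OF \<open>\<alpha> > 0\<close> c t])
    moreover have "\<psi> (x /\<^sub>R t powr (\<alpha> / 2)) (y /\<^sub>R t powr (\<alpha> / 2)) = \<psi> x (y /\<^sub>R t powr \<alpha>)"
      using scaling_property_divideR[of \<psi> "t powr (\<alpha> / 2)" "t powr (\<alpha> / 2)" x y] t \<psi>
      by (simp add: powr_add[symmetric])
    ultimately show "p' t x y = t powr (- (real CARD('n) * \<alpha> / 2)) *
        (exp C * exp (\<psi> (x /\<^sub>R t powr (\<alpha> / 2)) (y /\<^sub>R t powr (\<alpha> / 2)))) * 1 *
        exp (c (x /\<^sub>R t powr (\<alpha> / 2)) + c (y /\<^sub>R t powr (\<alpha> / 2)))"
      by (simp add: p'_def N_def add_divide_distrib mult_ac)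
  next
    fix r :: real and x y :: "real^'n" assume "r > 0"
    show "exp C * exp (\<psi> (r *\<^sub>R x) y) = exp C * exp (\<psi> x (r *\<^sub>R y))"
      by (simp only: \<psi>[OF \<open>r > 0\<close>, of x y])
    show "c (r *\<^sub>R x) = r powr (2 / \<alpha>) * c x" by (rule c[OF \<open>r > 0\<close>])
  qed
  moreover have "h_transform_related p' p"
    unfolding h_transform_related_def
    by (intro exI[of _ "\<lambda>x. exp (- g x)"] exI[of _ "- \<nu>"])
       (auto simp: rel exp_minus divide_inverse mult_ac)
  ultimately show ?thesis by (intro exI conjI)
qed

lemma homogeneous_density_of_inversion_form:
  assumes "\<alpha> > 0" "semigroup_densities p'" "has_inversion_form \<alpha> \<Phi> \<theta> \<rho> p'" "h_transform_related p' p"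
  shows "\<exists>r. \<forall>s t a b. 0 < s \<longrightarrow> s < t \<longrightarrow> inversion_density \<alpha> p x s t a b = r (t - s) a b"
proof -
  obtain k where "\<And>s t a b. 0 < s \<Longrightarrow> s < t \<Longrightarrow> inversion_density \<alpha> p' x s t a b =
       \<Phi> x b / \<Phi> x a * exp ((t - s) * \<rho> x) * (\<Phi> b (a /\<^sub>R (t - s) powr \<alpha>) * k (t - s) a b)"
    by (rule inversion_density_of_form[OF assms(1,3) semigroup_densities_pos[OF assms(2)]]) (auto intro: that)
  thus ?thesis
    using inversion_density_h_transform[OF assms(4)]
    by (intro exI[of _ "\<lambda>u a b. \<Phi> x b / \<Phi> x a * exp (u * \<rho> x) * (\<Phi> b (a /\<^sub>R u powr \<alpha>) * k u a b)"]) simp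
qed

lemma inversion_density_of_symmetric_form:
  assumes "\<alpha> > 0" "semigroup_densities p" and form: "has_inversion_form \<alpha> \<Phi> \<theta> \<rho> p"
    and sym: "\<And>x y. \<Phi> x y = \<Phi> y x" and st: "0 < s" "s < t"
  shows "inversion_density \<alpha> p x s t a b = \<Phi> x b / \<Phi> x a * exp ((t - s) * \<rho> x) * p (t - s) a b"
proof -
  have "\<forall>c>0. \<forall>x y. \<Phi> (c *\<^sub>R x) y = \<Phi> x (c *\<^sub>R y)"
    using form unfolding has_inversion_form_def scaling_properties_def by simp
  hence "\<Phi> b (a /\<^sub>R (t - s) powr \<alpha>) = \<Phi> a (b /\<^sub>R (t - s) powr \<alpha>)"
    using scaling_property_divideR[of \<Phi> "(t - s) powr \<alpha>" 1 a b] sym st by simp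
  moreover obtain k where "\<And>u a b. u > 0 \<Longrightarrow> p u a b = \<Phi> a (b /\<^sub>R u powr \<alpha>) * k u a b"
    "\<And>x s t a b. 0 < s \<Longrightarrow> s < t \<Longrightarrow> inversion_density \<alpha> p x s t a b =
       \<Phi> x b / \<Phi> x a * exp ((t - s) * \<rho> x) * (\<Phi> b (a /\<^sub>R (t - s) powr \<alpha>) * k (t - s) a b)"
    by (rule inversion_density_of_form[OF assms(1) form semigroup_densities_pos[OF assms(2)]], assumption) (rule that)
  ultimately show ?thesis using st by simp
qed

theorem theorem2p3:
  fixes \<alpha> :: real
    and P :: "real^'n \<Rightarrow> 'w measure"
    and X :: "real \<Rightarrow> 'w \<Rightarrow> real^'n"
    and p :: "real \<Rightarrow> real^'n \<Rightarrow> real^'n \<Rightarrow> real"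
  assumes "\<alpha> > 0"
    and "semigroup_densities p"
    and "markov_family P X p"
  shows "((\<forall>x. homogeneous_markov_with_densities (P x) {0<..}
                 (time_inversion \<alpha> X) (inversion_density \<alpha> p x))
            \<longleftrightarrow> (\<exists>\<Phi> \<theta> \<rho>. has_inversion_form \<alpha> \<Phi> \<theta> \<rho> p) \<or>
                (\<exists>p' \<Phi> \<theta> \<rho>. semigroup_densities p' \<and> has_inversion_form \<alpha> \<Phi> \<theta> \<rho> p'
                              \<and> h_transform_related p' p))
       \<and> (\<forall>\<Phi> \<theta> \<rho>. has_inversion_form \<alpha> \<Phi> \<theta> \<rho> p \<and> (\<forall>x y. \<Phi> x y = \<Phi> y x) \<longrightarrow>
            (\<forall>x s t a b. 0 < s \<and> s < t \<longrightarrow>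
               inversion_density \<alpha> p x s t a b
                 = \<Phi> x b / \<Phi> x a * exp ((t - s) * \<rho> x) * p (t - s) a b))"
proof (intro conjI allI impI iffI)
  assume "\<forall>x. homogeneous_markov_with_densities (P x) {0<..} (time_inversion \<alpha> X) (inversion_density \<alpha> p x)"
  hence 1: "\<exists>r. \<forall>s\<in>{0<..}. \<forall>t\<in>{0<..}. s < t \<longrightarrow> (\<forall>a b. inversion_density \<alpha> p x s t a b = r (t - s) a b)" for x
    unfolding homogeneous_markov_with_densities_def by simp
  have "\<exists>r. \<forall>s t a b. 0 < s \<longrightarrow> s < t \<longrightarrow> inversion_density \<alpha> p x s t a b = r (t - s) a b" for x
    by (rule ex_forward[OF 1[of x]]) simp
  from inversion_form_of_homogeneous_density[OF assms(1,2) this]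
  show "(\<exists>\<Phi> \<theta> \<rho>. has_inversion_form \<alpha> \<Phi> \<theta> \<rho> p) \<or>
    (\<exists>p' \<Phi> \<theta> \<rho>. semigroup_densities p' \<and> has_inversion_form \<alpha> \<Phi> \<theta> \<rho> p' \<and> h_transform_related p' p)"
    by (rule disjI2)
next
  fix x
  have refl: "h_transform_related p p"
    unfolding h_transform_related_def by (intro exI[of _ "\<lambda>_. 1"] exI[of _ 0]) simp
  assume "(\<exists>\<Phi> \<theta> \<rho>. has_inversion_form \<alpha> \<Phi> \<theta> \<rho> p) \<or>
    (\<exists>p' \<Phi> \<theta> \<rho>. semigroup_densities p' \<and> has_inversion_form \<alpha> \<Phi> \<theta> \<rho> p' \<and> h_transform_related p' p)"
  hence "\<exists>p' \<Phi> \<theta> \<rho>. semigroup_densities p' \<and> has_inversion_form \<alpha> \<Phi> \<theta> \<rho> p' \<and> h_transform_related p' p"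
  proof
    assume "\<exists>\<Phi> \<theta> \<rho>. has_inversion_form \<alpha> \<Phi> \<theta> \<rho> p"
    thus ?thesis using assms(2) refl by (intro exI[of _ p]) simp
  qed
  then obtain p' \<Phi> \<theta> \<rho> where "semigroup_densities p'" "has_inversion_form \<alpha> \<Phi> \<theta> \<rho> p'" "h_transform_related p' p"
    by (elim exE conjE)
  from homogeneous_density_of_inversion_form[OF assms(1) this]
  obtain r where "\<forall>s t a b. 0 < s \<longrightarrow> s < t \<longrightarrow> inversion_density \<alpha> p x s t a b = r (t - s) a b" ..
  moreover have "markov_with_densities (P x) {0<..} (time_inversion \<alpha> X) (inversion_density \<alpha> p x)"
    using assms(3) unfolding markov_family_def
    by (intro markov_time_inversion[OF _ assms(2)]) simp_all
  ultimately show "homogeneous_markov_with_densities (P x) {0<..} (time_inversion \<alpha> X) (inversion_density \<alpha> p x)"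
    unfolding homogeneous_markov_with_densities_def by (intro conjI exI[of _ r]) simp_all
next
  fix \<Phi> \<theta> \<rho> and x a b :: "real^'n" and s t :: real
  assume "has_inversion_form \<alpha> \<Phi> \<theta> \<rho> p \<and> (\<forall>x y. \<Phi> x y = \<Phi> y x)" "0 < s \<and> s < t"
  thus "inversion_density \<alpha> p x s t a b = \<Phi> x b / \<Phi> x a * exp ((t - s) * \<rho> x) * p (t - s) a b"
    by (intro inversion_density_of_symmetric_form[OF assms(1,2)]) auto
qed

end
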